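(* Thompson's group $F$ first-order interprets, with parameters, the restricted wreath product $\mathbf{Z} \wr \mathbf{Z}$.
   Context: Thompson's group $F$ is realized as the group $\mathrm{PL}_2([0,1])$, under composition, of all continuous order-preserving piecewise linear maps from $[0,1]$ onto itself with finitely many breakpoints, all occurring at dyadic rationals, and with the slopes of all linear pieces equal to (integer) powers of two. The restricted wreath product $\mathbf{Z} \wr \mathbf{Z}$ is the semidirect product of $\bigoplus_{k \in \mathbf{Z}} \mathbf{Z}$ with $\mathbf{Z}$ acting by shifting coordinates; it has the presentation $\langle a,b \mid [b, a^{-n} b a^n],\ n \in \mathbf{Z}\rangle$. A group $M$ first-order interprets with parameters a group $N$ if there are, for some $n \geq 1$, a subset $D \subseteq M^n$ and an equivalence relation $E$ on $D$, both definable in $M$ by first-order formulas of the language of groups with finitely many parameters from $M$, together with a bijection $D/E \to N$ under which the group multiplication of $N$ corresponds to a relation on $D$ that is likewise first-order definable in $M$ with parameters. *)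

theory Defs
  imports "HOL-Analysis.Analysis" "HOL-Algebra.Algebra"
begin

section \<open>First-order logic of groups with parameters\<close>

text \<open>
  Parameters occur as constants \<open>Param c\<close> naming elements of the structure, so a single formula
  involves only finitely many of them.
\<close>

datatype 'a grp_term =
    Var nat
  | Param 'a
  | One
  | Mult "'a grp_term" "'a grp_term"
  | Inv "'a grp_term"

datatype 'a grp_formula =
    Eq "'a grp_term" "'a grp_term"
  | Neg "'a grp_formula"
  | Conj "'a grp_formula" "'a grp_formula"
  | Exists nat "'a grp_formula"

primrec term_value :: "('a, 'm) monoid_scheme \<Rightarrow> (nat \<Rightarrow> 'a) \<Rightarrow> 'a grp_term \<Rightarrow> 'a" where
  "term_value M e (Var i) = e i"
| "term_value M e (Param c) = c"
| "term_value M e One = \<one>\<^bsub>M\<^esub>"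
| "term_value M e (Mult s t) = term_value M e s \<otimes>\<^bsub>M\<^esub> term_value M e t"
| "term_value M e (Inv t) = inv\<^bsub>M\<^esub> (term_value M e t)"

primrec satisfies :: "('a, 'm) monoid_scheme \<Rightarrow> (nat \<Rightarrow> 'a) \<Rightarrow> 'a grp_formula \<Rightarrow> bool" where
  "satisfies M e (Eq s t) \<longleftrightarrow> term_value M e s = term_value M e t"
| "satisfies M e (Neg \<phi>) \<longleftrightarrow> \<not> satisfies M e \<phi>"
| "satisfies M e (Conj \<phi> \<psi>) \<longleftrightarrow> satisfies M e \<phi> \<and> satisfies M e \<psi>"
| "satisfies M e (Exists i \<phi>) \<longleftrightarrow> (\<exists>a\<in>carrier M. satisfies M (e(i := a)) \<phi>)"

primrec term_vars :: "'a grp_term \<Rightarrow> nat set" where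
  "term_vars (Var i) = {i}"
| "term_vars (Param c) = {}"
| "term_vars One = {}"
| "term_vars (Mult s t) = term_vars s \<union> term_vars t"
| "term_vars (Inv t) = term_vars t"

primrec free_vars :: "'a grp_formula \<Rightarrow> nat set" where
  "free_vars (Eq s t) = term_vars s \<union> term_vars t"
| "free_vars (Neg \<phi>) = free_vars \<phi>"
| "free_vars (Conj \<phi> \<psi>) = free_vars \<phi> \<union> free_vars \<psi>"
| "free_vars (Exists i \<phi>) = free_vars \<phi> - {i}"

text \<open>The set of parameters of a formula is the generated set function \<open>set_grp_formula\<close>.\<close>

definition tuples :: "('a, 'm) monoid_scheme \<Rightarrow> nat \<Rightarrow> 'a list set" where
  "tuples M n = {xs. length xs = n \<and> set xs \<subseteq> carrier M}"

text \<open>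
  Only the free variables below \<open>n\<close> are allowed, so the values of \<open>(!) xs\<close> beyond the length of
  \<open>xs\<close> play no role.
\<close>

definition definable :: "('a, 'm) monoid_scheme \<Rightarrow> nat \<Rightarrow> 'a list set \<Rightarrow> bool" where
  "definable M n S \<longleftrightarrow>
     (\<exists>\<phi>. set_grp_formula \<phi> \<subseteq> carrier M \<and> free_vars \<phi> \<subseteq> {..<n} \<and>
          S = {xs \<in> tuples M n. satisfies M ((!) xs) \<phi>})"

text \<open>Relations on \<open>n\<close>-tuples are identified with sets of concatenated tuples.\<close>

definition interprets_with_parameters ::
    "('a, 'm) monoid_scheme \<Rightarrow> ('b, 'k) monoid_scheme \<Rightarrow> bool" where
  "interprets_with_parameters M N \<longleftrightarrow>
     (\<exists>n\<ge>1. \<exists>D E h.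
        definable M n D \<and>
        equiv D E \<and>
        definable M (2 * n) {xs @ ys | xs ys. (xs, ys) \<in> E} \<and>
        bij_betw h (D // E) (carrier N) \<and>
        definable M (3 * n)
          {xs @ ys @ zs | xs ys zs. xs \<in> D \<and> ys \<in> D \<and> zs \<in> D \<and>
             h (E `` {xs}) \<otimes>\<^bsub>N\<^esub> h (E `` {ys}) = h (E `` {zs})})"

section \<open>Thompson's group\<close>

text \<open>
  The set \<open>B\<close> contains the breakpoints: on every open subinterval of \<open>[0,1]\<close> avoiding \<open>B\<close> the map
  is affine with slope an integer power of two. The library constant \<open>dyadics\<close> consists of the
  nonnegative dyadic rationals. Maps are made extensional outside \<open>[0,1]\<close>, so that equality of
  functions is equality on \<open>[0,1]\<close>.
\<close>

definition PL2 :: "(real \<Rightarrow> real) set" where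
  "PL2 = {f \<in> extensional {0..1}.
     continuous_on {0..1} f \<and> mono_on {0..1} f \<and> f ` {0..1} = {0..1} \<and>
     (\<exists>B. finite B \<and> B \<subseteq> dyadics \<and>
        (\<forall>a b. 0 \<le> a \<and> a < b \<and> b \<le> 1 \<and> {a<..<b} \<inter> B = {} \<longrightarrow>
           (\<exists>(k::int) c. \<forall>x\<in>{a<..<b}. f x = 2 powi k * x + c)))}"

definition thompson_F :: "(real \<Rightarrow> real) monoid" where
  "thompson_F = \<lparr>carrier = PL2, mult = compose {0..1}, one = (\<lambda>x\<in>{0..1}. x)\<rparr>"

section \<open>The restricted wreath product\<close>

definition semidirect_product ::
    "('a, 'm) monoid_scheme \<Rightarrow> ('b, 'k) monoid_scheme \<Rightarrow> ('b \<Rightarrow> 'a \<Rightarrow> 'a) \<Rightarrow> ('a \<times> 'b) monoid" where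
  "semidirect_product G H \<alpha> =
     \<lparr>carrier = carrier G \<times> carrier H,
      mult = (\<lambda>(x, h) (y, k). (x \<otimes>\<^bsub>G\<^esub> \<alpha> h y, h \<otimes>\<^bsub>H\<^esub> k)),
      one = (\<one>\<^bsub>G\<^esub>, \<one>\<^bsub>H\<^esub>)\<rparr>"

definition Z_wr_Z :: "((int \<Rightarrow> int) \<times> int) monoid" where
  "Z_wr_Z = semidirect_product (sum_group (UNIV :: int set) (\<lambda>_. integer_group)) integer_group
     (\<lambda>m f k. f (k - m))"

end

theory Submission
  imports Defs
begin

text \<open>
  Let \<open>a\<close> be the standard generator of \<open>F\<close>, which moves all of \<open>(0,1)\<close> to the left and has slope
  \<open>1/2\<close> at \<open>0\<close>, and let \<open>b\<close> be a copy of \<open>a\<close> squeezed into the fundamental domain \<open>[1/2, 3/4]\<close>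
  of \<open>a\<close>. A map commuting with a one-bump map is determined on the bump by its slope at the left end
  point, which is a power of two; as \<open>a\<close> and \<open>b\<close> have slope \<open>1/2\<close> there, the centralizer of
  \<open>a\<close> is \<open>\<langle>a\<rangle>\<close>, and a map commuting with all \<open>a\<^sup>n b a\<^sup>-\<^sup>n\<close> acts on each tile
  \<open>a\<^sup>n [1/2, 3/4]\<close> as a power of \<open>a\<^sup>n b a\<^sup>-\<^sup>n\<close>. Such a map is linear near \<open>0\<close> and \<open>1\<close> and fixes
  the end points of the tiles, so it is the identity on all but finitely many tiles. Hence the
  base group of \<open>\<langle>a, b\<rangle> \<cong> \<int> \<wr> \<int>\<close> is the set of elements commuting with \<open>c b c\<^sup>-\<^sup>1\<close> for all
  \<open>c\<close> commuting with \<open>a\<close>, and \<open>\<langle>a, b\<rangle>\<close> itself is definable as the product of this set with the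
  centralizer of \<open>a\<close>. Below, \<open>a\<close> is \<open>slide\<close> and \<open>b\<close> is \<open>wave\<close>.
\<close>

section \<open>Thompson's group is a group\<close>

lemma dyadics_add:
  assumes "x \<in> dyadics" "y \<in> dyadics"
  shows "x + y \<in> (dyadics :: real set)"
proof -
  obtain m k n l where xy: "x = of_nat m / 2 ^ k" "y = of_nat n / 2 ^ l"
    using assms unfolding dyadics_def by blast
  have "x + y = of_nat (m * 2 ^ l + n * 2 ^ k) / 2 ^ (k + l)"
    unfolding xy by (simp add: field_simps power_add)
  then show ?thesis unfolding dyadics_def by blast
qed

lemma dyadics_diff:
  assumes "x \<in> dyadics" "y \<in> dyadics" "y \<le> x"
  shows "x - y \<in> (dyadics :: real set)"
proof -
  obtain m k n l where xy: "x = of_nat m / 2 ^ k" "y = of_nat n / 2 ^ l"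
    using assms unfolding dyadics_def by blast
  have "real (n * 2 ^ k) \<le> real (m * 2 ^ l)"
    using \<open>y \<le> x\<close> unfolding xy by (simp add: field_simps)
  then have "n * 2 ^ k \<le> m * 2 ^ l" by linarith
  then have "x - y = of_nat (m * 2 ^ l - n * 2 ^ k) / 2 ^ (k + l)"
    unfolding xy by (simp add: field_simps power_add of_nat_diff)
  then show ?thesis unfolding dyadics_def by blast
qed

lemma dyadics_scale:
  assumes "x \<in> dyadics"
  shows "2 powi n * x \<in> (dyadics :: real set)"
proof -
  obtain m k where x: "x = of_nat m / 2 ^ k"
    using assms unfolding dyadics_def by blast
  show ?thesis
  proof (cases "n \<ge> 0")
    case True
    then have "2 powi n * x = of_nat (2 ^ nat n * m) / 2 ^ k"
      by (simp add: x power_int_def)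
    then show ?thesis unfolding dyadics_def by blast
  next
    case False
    then have "2 powi n * x = of_nat m / 2 ^ (k + nat (- n))"
      by (simp add: x power_int_def power_add field_simps)
    then show ?thesis unfolding dyadics_def by blast
  qed
qed

lemma dyadics_scale_iff:
  "2 powi n * x \<in> (dyadics :: real set) \<longleftrightarrow> x \<in> dyadics"
proof
  assume "2 powi n * x \<in> dyadics"
  then have "2 powi (- n) * (2 powi n * x) \<in> dyadics" by (rule dyadics_scale)
  then show "x \<in> dyadics" by (simp add: power_int_minus flip: mult.assoc)
qed (rule dyadics_scale)

text \<open>Since \<open>dyadics\<close> contains no negative numbers, \<open>0 \<le> y\<close> is
  what allows \<open>x\<close> to be subtracted again.\<close>

lemma dyadics_add_iff:
  assumes "x \<in> dyadics" "0 \<le> y"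
  shows "x + y \<in> (dyadics :: real set) \<longleftrightarrow> y \<in> dyadics"
  using dyadics_diff[of "x + y" x] dyadics_add[of x y] assms by auto

text \<open>The affinity clause of \<open>PL2\<close>, isolated so that the witness \<open>B\<close>
  can be passed between lemmas.\<close>

definition breakpoints_in :: "real set \<Rightarrow> (real \<Rightarrow> real) \<Rightarrow> bool" where
  "breakpoints_in B f \<longleftrightarrow> (\<forall>a b. 0 \<le> a \<and> a < b \<and> b \<le> 1 \<and> {a<..<b} \<inter> B = {} \<longrightarrow>
           (\<exists>(k::int) c. \<forall>x\<in>{a<..<b}. f x = 2 powi k * x + c))"

lemma breakpoints_inD:
  assumes "breakpoints_in B f" "0 \<le> a" "a < b" "b \<le> 1" "{a<..<b} \<inter> B = {}"
  obtains k c where "\<And>x. a < x \<Longrightarrow> x < b \<Longrightarrow> f x = 2 powi (k::int) * x + c"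
  using assms unfolding breakpoints_in_def by (metis greaterThanLessThan_iff)

text \<open>Continuity extends the affine formula from the open interval to its closure. Anchoring
  it at \<open>a\<close> then removes the additive constant.\<close>

lemma breakpoints_in_closed:
  assumes B: "breakpoints_in B f" and ab: "0 \<le> a" "a < b" "b \<le> 1" "{a<..<b} \<inter> B = {}"
    and cont: "continuous_on {0..1} f"
  obtains k where "\<And>x. a \<le> x \<Longrightarrow> x \<le> b \<Longrightarrow> f x = f a + 2 powi (k::int) * (x - a)"
proof -
  obtain k c where kc: "\<And>x. a < x \<Longrightarrow> x < b \<Longrightarrow> f x = 2 powi k * x + c"
    using breakpoints_inD[OF B ab] by blast
  have cont_ab: "continuous_on {a..b} f"
    by (rule continuous_on_subset[OF cont]) (use ab in auto)
  have "f x = 2 powi k * x + c" if x: "x \<in> {a..b}" for x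
  proof -
    let ?h = "\<lambda>x. f x - (2 powi k * x + c)"
    have "?h x = 0"
    proof (rule continuous_constant_on_closure[where S = "{a<..<b}" and f = ?h])
      show "continuous_on (closure {a<..<b}) ?h"
        using cont_ab ab by (auto intro!: continuous_intros)
    qed (use kc x ab in auto)
    then show ?thesis by simp
  qed
  then have "f x = f a + 2 powi k * (x - a)" if "a \<le> x" "x \<le> b" for x
    using that ab by (simp add: algebra_simps)
  then show thesis by (rule that)
qed

text \<open>Finitely many points cannot accumulate at \<open>x\<close>: take the least one to its
  right. Inserting \<open>y\<close> keeps the set nonempty and the result at most
  \<open>y\<close>.\<close>

lemma gap_right:
  fixes x y :: real
  assumes "finite B" "x < y"
  obtains z where "x < z" "z \<le> y" "{x<..<z} \<inter> B = {}"
proof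
  let ?S = "insert y {t \<in> B. x < t}"
  have fin: "finite ?S" using assms by simp
  show "x < Min ?S" using fin assms by auto
  show "Min ?S \<le> y" using fin by simp
  show "{x<..<Min ?S} \<inter> B = {}" using fin by auto
qed

lemma gap_left:
  fixes x y :: real
  assumes "finite B" "x < y"
  obtains z where "x \<le> z" "z < y" "{z<..<y} \<inter> B = {}"
proof
  let ?S = "insert x {t \<in> B. t < y}"
  have fin: "finite ?S" using assms by simp
  show "Max ?S < y" using fin assms by auto
  show "x \<le> Max ?S" using fin by simp
  show "{Max ?S<..<y} \<inter> B = {}" using fin by fastforce
qed

section \<open>Order and dyadic points under the maps of F\<close>

lemma PL2_cont: "f \<in> PL2 \<Longrightarrow> continuous_on {0..1} f"
  and PL2_ext: "f \<in> PL2 \<Longrightarrow> f \<in> extensional {0..1}"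
  and PL2_mono: "f \<in> PL2 \<Longrightarrow> mono_on {0..1} f"
  and PL2_image: "f \<in> PL2 \<Longrightarrow> f ` {0..1} = {0..1}"
  by (auto simp: PL2_def)

lemma PL2_breakpoints:
  assumes "f \<in> PL2"
  obtains B where "finite B" "B \<subseteq> dyadics" "breakpoints_in B f"
proof -
  have "\<exists>B. finite B \<and> B \<subseteq> dyadics \<and> breakpoints_in B f"
    using assms unfolding PL2_def breakpoints_in_def by (elim CollectE conjE)
  then show thesis using that by blast
qed

text \<open>Just to the right of \<open>x\<close> the map is affine with positive slope, hence
  strictly increasing; monotonicity covers the rest of the way to \<open>y\<close>.\<close>

lemma PL2_strict_mono:
  assumes f: "f \<in> PL2" and xy: "x \<in> {0..1}" "y \<in> {0..1}" "x < y"
  shows "f x < f y"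
proof -
  obtain B where B: "finite B" "B \<subseteq> dyadics" "breakpoints_in B f" by (rule PL2_breakpoints[OF f])
  obtain z where z: "x < z" "z \<le> y" "{x<..<z} \<inter> B = {}" using gap_right[OF B(1) xy(3)] by blast
  have "0 \<le> x" "z \<le> 1" using xy z by auto
  then obtain k where k: "\<And>t. x \<le> t \<Longrightarrow> t \<le> z \<Longrightarrow> f t = f x + 2 powi (k::int) * (t - x)"
    using breakpoints_in_closed[OF B(3) _ z(1) _ z(3) PL2_cont[OF f]] by blast
  have "f z = f x + 2 powi k * (z - x)" by (rule k) (use z in auto)
  moreover have "2 powi k * (z - x) > 0" using z by simp
  ultimately have "f x < f z" by linarith
  moreover have "f z \<le> f y"
    using mono_onD[OF PL2_mono[OF f]] xy z by auto
  ultimately show ?thesis by simp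
qed

lemma PL2_less_iff:
  assumes "f \<in> PL2" "x \<in> {0..1}" "y \<in> {0..1}"
  shows "f x < f y \<longleftrightarrow> x < y"
  using PL2_strict_mono[OF assms] PL2_strict_mono[OF assms(1,3,2)]
  by (cases x y rule: linorder_cases) auto

lemma PL2_le_iff:
  assumes "f \<in> PL2" "x \<in> {0..1}" "y \<in> {0..1}"
  shows "f x \<le> f y \<longleftrightarrow> x \<le> y"
  using PL2_less_iff[OF assms(1,3,2)] by (simp add: not_less [symmetric])

lemma PL2_inj:
  assumes "f \<in> PL2"
  shows "inj_on f {0..1}"
  using PL2_strict_mono[OF assms] by (intro linorder_inj_onI') (metis order_less_irrefl)

lemma PL2_range: "f \<in> PL2 \<Longrightarrow> x \<in> {0..1} \<Longrightarrow> f x \<in> {0..1}"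
  using PL2_image by blast

lemma PL2_0: assumes "f \<in> PL2" shows "f 0 = 0"
proof -
  obtain x where "x \<in> {0..1}" "f x = 0"
    using PL2_image[OF assms] by (metis atLeastAtMost_iff image_iff order_refl zero_le_one)
  then show ?thesis
    using PL2_le_iff[OF assms, of 0 x] PL2_range[OF assms, of 0] by auto
qed

lemma PL2_1: assumes "f \<in> PL2" shows "f 1 = 1"
proof -
  obtain x where "x \<in> {0..1}" "f x = 1"
    using PL2_image[OF assms] by (metis atLeastAtMost_iff image_iff order_refl zero_le_one)
  then show ?thesis
    using PL2_le_iff[OF assms, of x 1] PL2_range[OF assms, of 1] by auto
qed

lemma PL2_I:
  assumes "f \<in> extensional {0..1}" "f ` {0..1} = {0..1}" "mono_on {0..1} f"
    "finite B" "B \<subseteq> dyadics" "breakpoints_in B f" "continuous_on {0..1} f"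
  shows "f \<in> PL2"
  unfolding PL2_def breakpoints_in_def[symmetric]
  by (intro CollectI conjI exI[of _ B] assms)

text \<open>Induction on the number of breakpoints below \<open>x\<close>. From the last such
  breakpoint to \<open>x\<close> the map is affine with slope a power of two, and neither scaling by
  powers of two nor shifting by a dyadic changes dyadicity. The lemma keeps breakpoints dyadic under
  composition and inversion.\<close>

lemma PL2_dyadic_iff:
  assumes f: "f \<in> PL2" and x: "x \<in> {0..1}"
  shows "f x \<in> dyadics \<longleftrightarrow> x \<in> dyadics"
proof -
  obtain B where B: "finite B" "B \<subseteq> dyadics" "breakpoints_in B f"
    by (rule PL2_breakpoints[OF f])
  show ?thesis using x
  proof (induction "card (B \<inter> {0<..<x})" arbitrary: x rule: less_induct)
    case less
    show ?case
    proof (cases "x = 0")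
      case True
      then show ?thesis using PL2_0[OF f] by simp
    next
      case False
      then have x: "0 < x" "x \<le> 1" using less.prems by auto
      \<comment> \<open>The anchor \<open>p\<close> is the last breakpoint before \<open>x\<close>,
        or 0 if there is none.\<close>
      obtain p where p: "0 \<le> p" "p < x" "{p<..<x} \<inter> B = {}" "p \<in> dyadics" "f p \<in> dyadics"
      proof (cases "B \<inter> {0<..<x} = {}")
        case True
        have "(0::real) \<in> dyadics" using real_in_dyadics[of 0] by simp
        with True x show thesis by (intro that[of 0]) (auto simp: PL2_0[OF f])
      next
        case False
        define p where "p = Max (B \<inter> {0<..<x})"
        have fin: "finite (B \<inter> {0<..<x})" using B by blast
        have p: "p \<in> B \<inter> {0<..<x}" unfolding p_def by (rule Max_in[OF fin False])
        have pmax: "q \<le> p" if "q \<in> B" "0 < q" "q < x" for q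
          unfolding p_def using fin that by (intro Max_ge) auto
        have "B \<inter> {0<..<p} \<subset> B \<inter> {0<..<x}" using p by auto
        then have "card (B \<inter> {0<..<p}) < card (B \<inter> {0<..<x})" by (rule psubset_card_mono[OF fin])
        then have "f p \<in> dyadics \<longleftrightarrow> p \<in> dyadics" by (rule less.hyps) (use p x in auto)
        moreover have "p \<in> dyadics" using p B(2) by blast
        moreover have "{p<..<x} \<inter> B = {}" using pmax p by force
        ultimately show thesis using p by (intro that[of p]) simp_all
      qed
      obtain k where k: "\<And>t. p \<le> t \<Longrightarrow> t \<le> x \<Longrightarrow> f t = f p + 2 powi (k::int) * (t - p)"
        using breakpoints_in_closed[OF B(3) p(1,2) x(2) p(3) PL2_cont[OF f]] by blast
      have "f x \<in> dyadics \<longleftrightarrow> f p + 2 powi k * (x - p) \<in> dyadics" using k[of x] p by simp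
      also have "\<dots> \<longleftrightarrow> p + (x - p) \<in> dyadics"
        using dyadics_add_iff[OF p(5), of "2 powi k * (x - p)"] dyadics_add_iff[OF p(4), of "x - p"] p(2)
        by (simp add: dyadics_scale_iff)
      finally show ?thesis by simp
    qed
  qed
qed

text \<open>The composite can break only where \<open>g\<close> breaks or where \<open>g\<close>
  hits a breakpoint of \<open>f\<close>. The latter points are finite in number because
  \<open>g\<close> is injective, and dyadic by \<open>PL2_dyadic_iff\<close>.\<close>

lemma PL2_compose:
  assumes f: "f \<in> PL2" and g: "g \<in> PL2"
  shows "compose {0..1} f g \<in> PL2"
proof -
  obtain B where B: "finite B" "B \<subseteq> dyadics" "breakpoints_in B f" by (rule PL2_breakpoints[OF f])
  obtain C where C: "finite C" "C \<subseteq> dyadics" "breakpoints_in C g" by (rule PL2_breakpoints[OF g])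
  define P where "P = {x \<in> {0..1}. g x \<in> B}"
  show ?thesis
  proof (rule PL2_I[where B = "C \<union> P"])
    show "compose {0..1} f g ` {0..1} = {0..1}"
      using PL2_image[OF f] PL2_image[OF g] by (metis surj_compose)
    show "mono_on {0..1} (compose {0..1} f g)"
      using PL2_range[OF g] PL2_le_iff[OF f] PL2_le_iff[OF g] by (auto intro!: mono_onI simp: compose_eq)
    have "P = g -` B \<inter> {0..1}" by (auto simp: P_def)
    then show "finite (C \<union> P)"
      using C(1) finite_vimage_IntI[OF B(1) PL2_inj[OF g]] by simp
    show "C \<union> P \<subseteq> dyadics"
      using C(2) B(2) PL2_dyadic_iff[OF g] by (auto simp: P_def)
    have "continuous_on {0..1} (f \<circ> g)"
      using PL2_cont[OF f] PL2_cont[OF g] PL2_image[OF g] by (metis continuous_on_compose)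
    then show "continuous_on {0..1} (compose {0..1} f g)"
      by (rule continuous_on_eq) (simp add: compose_eq)
    show "breakpoints_in (C \<union> P) (compose {0..1} f g)"
      unfolding breakpoints_in_def
    proof (intro allI impI, elim conjE)
      fix a b :: real
      assume ab: "0 \<le> a" "a < b" "b \<le> 1" "{a<..<b} \<inter> (C \<union> P) = {}"
      then have "{a<..<b} \<inter> C = {}" by auto
      from breakpoints_inD[OF C(3) ab(1-3) this] obtain k c
        where kc: "\<And>x. a < x \<Longrightarrow> x < b \<Longrightarrow> g x = 2 powi (k::int) * x + c" by blast
      have gab: "0 \<le> g a" "g a < g b" "g b \<le> 1"
        using PL2_range[OF g, of a] PL2_range[OF g, of b] PL2_less_iff[OF g, of a b] ab by auto
      have "{g a<..<g b} \<inter> B = {}"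
      proof (intro equals0I)
        fix y assume y: "y \<in> {g a<..<g b} \<inter> B"
        then have "y \<in> {0..1}" using gab by auto
        then obtain x where x: "x \<in> {0..1}" "y = g x" using PL2_image[OF g] by blast
        have "g a < g x" "g x < g b" using y by (simp_all add: x(2))
        then have "a < x" "x < b" using PL2_less_iff[OF g] x(1) ab by auto
        then show False using x y ab(4) by (auto simp: P_def)
      qed
      from breakpoints_inD[OF B(3) gab this] obtain l d
        where ld: "\<And>y. g a < y \<Longrightarrow> y < g b \<Longrightarrow> f y = 2 powi (l::int) * y + d" by blast
      have "compose {0..1} f g x = 2 powi (l + k) * x + (2 powi l * c + d)" if x: "x \<in> {a<..<b}" for x
      proof -
        have "g a < g x" "g x < g b" using PL2_less_iff[OF g] x ab by auto
        then show ?thesis using ld kc x ab by (simp add: compose_eq power_int_add algebra_simps)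
      qed
      then show "\<exists>k c. \<forall>x\<in>{a<..<b}. compose {0..1} f g x = 2 powi k * x + c" by blast
    qed
  qed (simp add: compose_extensional)
qed

text \<open>The inverse breaks only at images of breakpoints. \<open>B\<close> may stick out of the
  unit interval, where \<open>f\<close> carries no information, so it is cut down first.\<close>

lemma PL2_inverse:
  assumes f: "f \<in> PL2"
  obtains g where "g \<in> PL2" "\<And>x. x \<in> {0..1} \<Longrightarrow> g (f x) = x" "\<And>x. x \<in> {0..1} \<Longrightarrow> f (g x) = x"
proof -
  obtain B where B: "finite B" "B \<subseteq> dyadics" "breakpoints_in B f" by (rule PL2_breakpoints[OF f])
  define g where "g = restrict (inv_into {0..1} f) {0..1}"
  have gf: "g (f x) = x" if "x \<in> {0..1}" for x
    using that PL2_inj[OF f] PL2_range[OF f that] by (simp add: g_def)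
  have fg: "f (g x) = x" if "x \<in> {0..1}" for x
    using that f_inv_into_f[of x f "{0..1}"] PL2_image[OF f] unfolding g_def by auto
  have g01: "g x \<in> {0..1}" if "x \<in> {0..1}" for x
    using that inv_into_into[of x f "{0..1}"] PL2_image[OF f] unfolding g_def by auto
  have "g \<in> PL2"
  proof (rule PL2_I[where B = "f ` (B \<inter> {0..1})"])
    show "g ` {0..1} = {0..1}"
    proof (intro equalityI subsetI)
      fix x :: real assume "x \<in> {0..1}"
      then show "x \<in> g ` {0..1}" using gf PL2_range[OF f] by (metis image_eqI)
    qed (use g01 in blast)
    show "mono_on {0..1} g"
      using g01 fg PL2_le_iff[OF f] by (metis mono_onI)
    show "finite (f ` (B \<inter> {0..1}))" using B by simp
    show "f ` (B \<inter> {0..1}) \<subseteq> dyadics" using B PL2_dyadic_iff[OF f] by auto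
    show "continuous_on {0..1} g"
      using continuous_on_inv[OF PL2_cont[OF f], of g] gf PL2_image[OF f] by simp
    show "breakpoints_in (f ` (B \<inter> {0..1})) g"
      unfolding breakpoints_in_def
    proof (intro allI impI, elim conjE)
      fix a b :: real
      assume ab: "0 \<le> a" "a < b" "b \<le> 1" "{a<..<b} \<inter> f ` (B \<inter> {0..1}) = {}"
      have iff: "g x < g y \<longleftrightarrow> x < y" if "x \<in> {0..1}" "y \<in> {0..1}" for x y
        using PL2_less_iff[OF f g01 g01, OF that] fg that by simp
      have gab: "0 \<le> g a" "g a < g b" "g b \<le> 1"
        using g01[of a] g01[of b] iff[of a b] ab by auto
      have "{g a<..<g b} \<inter> B = {}"
      proof (intro equals0I)
        fix y assume y: "y \<in> {g a<..<g b} \<inter> B"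
        then have y01: "y \<in> {0..1}" using gab by auto
        then have "a < f y" "f y < b"
          using PL2_less_iff[OF f, of "g a" y] PL2_less_iff[OF f, of y "g b"] fg[of a] fg[of b] g01[of a] g01[of b] ab y
          by auto
        then show False using y y01 ab(4) by auto
      qed
      from breakpoints_inD[OF B(3) gab this] obtain k c
        where kc: "\<And>y. g a < y \<Longrightarrow> y < g b \<Longrightarrow> f y = 2 powi (k::int) * y + c" by blast
      have "g x = 2 powi (- k) * x + (- (2 powi (- k) * c))" if x: "x \<in> {a<..<b}" for x
      proof -
        have "g a < g x" "g x < g b" using iff x ab by auto
        then have "x = 2 powi k * g x + c" using kc[of "g x"] fg[of x] x ab by simp
        then show ?thesis by (simp add: power_int_minus field_simps)
      qed
      then show "\<exists>k c. \<forall>x\<in>{a<..<b}. g x = 2 powi k * x + c" by blast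
    qed
  qed (simp add: g_def)
  then show thesis using gf fg by (rule that)
qed

section \<open>The group laws of F\<close>

lemma thompson_F_carrier [simp]: "carrier thompson_F = PL2"
  and thompson_F_mult: "f \<otimes>\<^bsub>thompson_F\<^esub> g = compose {0..1} f g"
  and thompson_F_one: "\<one>\<^bsub>thompson_F\<^esub> = (\<lambda>x\<in>{0..1}. x)"
  by (simp_all add: thompson_F_def)

lemma thompson_F_mult_apply [simp]:
  "x \<in> {0..1} \<Longrightarrow> (f \<otimes>\<^bsub>thompson_F\<^esub> g) x = f (g x)"
  by (simp add: thompson_F_mult compose_eq)

lemma thompson_F_one_apply [simp]: "x \<in> {0..1} \<Longrightarrow> \<one>\<^bsub>thompson_F\<^esub> x = x"
  by (simp add: thompson_F_one)

lemma PL2_eqI: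
  assumes "f \<in> PL2" "g \<in> PL2" "\<And>x. x \<in> {0..1} \<Longrightarrow> f x = g x"
  shows "f = g"
  using assms(3) by (rule extensionalityI[OF PL2_ext[OF assms(1)] PL2_ext[OF assms(2)]])

lemma thompson_F_group: "group thompson_F"
proof (rule groupI)
  show closed: "f \<otimes>\<^bsub>thompson_F\<^esub> g \<in> carrier thompson_F"
    if "f \<in> carrier thompson_F" "g \<in> carrier thompson_F" for f g
    using that PL2_compose by (simp add: thompson_F_mult)
  have "(\<lambda>x\<in>{0..1::real}. x) \<in> PL2"
  proof (rule PL2_I[where B = "{}"])
    show "breakpoints_in {} (\<lambda>x\<in>{0..1}. x)"
      unfolding breakpoints_in_def by (auto intro!: exI[of _ 0])
    show "continuous_on {0..1::real} (\<lambda>x\<in>{0..1::real}. x)"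
      by (rule continuous_on_eq[of _ "\<lambda>x. x"]) auto
  qed (auto intro!: mono_onI)
  then show one: "\<one>\<^bsub>thompson_F\<^esub> \<in> carrier thompson_F" by (simp add: thompson_F_one)
  show "f \<otimes>\<^bsub>thompson_F\<^esub> g \<otimes>\<^bsub>thompson_F\<^esub> h = f \<otimes>\<^bsub>thompson_F\<^esub> (g \<otimes>\<^bsub>thompson_F\<^esub> h)"
    if "f \<in> carrier thompson_F" "g \<in> carrier thompson_F" "h \<in> carrier thompson_F" for f g h
    using that closed PL2_range by (intro PL2_eqI) auto
  show "\<one>\<^bsub>thompson_F\<^esub> \<otimes>\<^bsub>thompson_F\<^esub> f = f" if "f \<in> carrier thompson_F" for f
    using that closed one PL2_range by (intro PL2_eqI) auto
  show "\<exists>g\<in>carrier thompson_F. g \<otimes>\<^bsub>thompson_F\<^esub> f = \<one>\<^bsub>thompson_F\<^esub>"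
    if "f \<in> carrier thompson_F" for f
  proof -
    from that have f: "f \<in> PL2" by simp
    obtain g where g: "g \<in> PL2" "\<And>x. x \<in> {0..1} \<Longrightarrow> g (f x) = x"
      by (rule PL2_inverse[OF f]) blast
    then have "g \<otimes>\<^bsub>thompson_F\<^esub> f = \<one>\<^bsub>thompson_F\<^esub>"
      using that closed one by (intro PL2_eqI) auto
    with g show ?thesis by auto
  qed
qed

interpretation thompson: group thompson_F
  by (rule thompson_F_group)

section \<open>Integer powers\<close>

abbreviation mult_F :: "(real \<Rightarrow> real) \<Rightarrow> (real \<Rightarrow> real) \<Rightarrow> real \<Rightarrow> real" (infixl "\<circ>\<^sub>F" 70)
  where "f \<circ>\<^sub>F g \<equiv> f \<otimes>\<^bsub>thompson_F\<^esub> g"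

abbreviation pow_F :: "(real \<Rightarrow> real) \<Rightarrow> int \<Rightarrow> real \<Rightarrow> real" (infixr "^\<^sub>F" 80)
  where "f ^\<^sub>F n \<equiv> f [^]\<^bsub>thompson_F\<^esub> n"

lemma mult_F_closed [simp, intro]: "f \<in> PL2 \<Longrightarrow> g \<in> PL2 \<Longrightarrow> f \<circ>\<^sub>F g \<in> PL2"
  using thompson.m_closed by simp

lemma pow_F_closed [simp, intro]: "f \<in> PL2 \<Longrightarrow> f ^\<^sub>F n \<in> PL2"
  using thompson.int_pow_closed by simp

lemma inv_F_closed [simp, intro]: "f \<in> PL2 \<Longrightarrow> inv\<^bsub>thompson_F\<^esub> f \<in> PL2"
  using thompson.inv_closed by simp

lemma inv_F_apply:
  assumes "f \<in> PL2" "x \<in> {0..1}"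
  shows "(inv\<^bsub>thompson_F\<^esub> f) (f x) = x" "f ((inv\<^bsub>thompson_F\<^esub> f) x) = x"
proof -
  have "(inv\<^bsub>thompson_F\<^esub> f) \<circ>\<^sub>F f = \<one>\<^bsub>thompson_F\<^esub>" "f \<circ>\<^sub>F (inv\<^bsub>thompson_F\<^esub> f) = \<one>\<^bsub>thompson_F\<^esub>"
    using assms(1) by simp_all
  from this[THEN fun_cong, of x] assms(2)
  show "(inv\<^bsub>thompson_F\<^esub> f) (f x) = x" "f ((inv\<^bsub>thompson_F\<^esub> f) x) = x" by simp_all
qed

lemma pow_F_add: "f \<in> PL2 \<Longrightarrow> f ^\<^sub>F (m + n) = f ^\<^sub>F m \<circ>\<^sub>F f ^\<^sub>F n"
  using thompson.int_pow_mult[of f] by simp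

lemma pow_F_add_apply:
  "f \<in> PL2 \<Longrightarrow> x \<in> {0..1} \<Longrightarrow> (f ^\<^sub>F (m + n)) x = (f ^\<^sub>F m) ((f ^\<^sub>F n) x)"
  by (simp add: pow_F_add)

lemma pow_F_cancel:
  assumes "f \<in> PL2" "x \<in> {0..1}"
  shows "(f ^\<^sub>F (- n)) ((f ^\<^sub>F n) x) = x" "(f ^\<^sub>F n) ((f ^\<^sub>F (- n)) x) = x"
  using pow_F_add_apply[OF assms, of "- n" n] pow_F_add_apply[OF assms, of n "- n"] assms(2)
  by simp_all

text \<open>Induction in both directions from exponent 0. The predicate sees the exponent and the
  power together, and each step adds one factor on the left.\<close>

lemma pow_F_induct [consumes 1, case_names zero succ pred]:
  assumes f: "f \<in> PL2" and zero: "P 0 \<one>\<^bsub>thompson_F\<^esub>"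
    and succ: "\<And>n. P n (f ^\<^sub>F n) \<Longrightarrow> P (n + 1) (f \<circ>\<^sub>F f ^\<^sub>F n)"
    and pred: "\<And>n. P n (f ^\<^sub>F n) \<Longrightarrow> P (n - 1) (inv\<^bsub>thompson_F\<^esub> f \<circ>\<^sub>F f ^\<^sub>F n)"
  shows "P n (f ^\<^sub>F n)"
proof (induction n rule: int_induct[where k = 0])
  case base
  then show ?case using zero by simp
next
  case (step1 i)
  have "f ^\<^sub>F (i + 1) = f \<circ>\<^sub>F f ^\<^sub>F i"
    using pow_F_add[OF f, of 1 i] f by (simp add: add.commute)
  then show ?case using succ[OF step1(2)] by simp
next
  case (step2 i)
  have "f ^\<^sub>F (i - 1) = inv\<^bsub>thompson_F\<^esub> f \<circ>\<^sub>F f ^\<^sub>F i"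
    using pow_F_add[OF f, of "-1" i] thompson.int_pow_neg[of f 1] f by simp
  then show ?case using pred[OF step2(2)] by simp
qed

lemma pow_F_fixed:
  assumes f: "f \<in> PL2" and x: "x \<in> {0..1}" "f x = x"
  shows "(f ^\<^sub>F n) x = x"
  using f
proof (induction rule: pow_F_induct)
  case (pred n)
  then show ?case using inv_F_apply(1)[OF f x(1)] x by simp
qed (use x in simp_all)

text \<open>A map commuting with \<open>f\<close> also commutes with its inverse, hence with every
  power.\<close>

lemma pow_F_commute:
  assumes "f \<in> PL2" "g \<in> PL2" "g \<circ>\<^sub>F f = f \<circ>\<^sub>F g"
  shows "g \<circ>\<^sub>F f ^\<^sub>F n = f ^\<^sub>F n \<circ>\<^sub>F g"
  using assms(1)
proof (induction rule: pow_F_induct)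
  case zero
  then show ?case using assms by simp
next
  case (succ n)
  have "g \<circ>\<^sub>F (f \<circ>\<^sub>F f ^\<^sub>F n) = f \<circ>\<^sub>F (g \<circ>\<^sub>F f ^\<^sub>F n)"
    using assms by (simp flip: thompson.m_assoc)
  then show ?case using assms succ by (simp add: thompson.m_assoc)
next
  case (pred n)
  have "g \<circ>\<^sub>F inv\<^bsub>thompson_F\<^esub> f = inv\<^bsub>thompson_F\<^esub> f \<circ>\<^sub>F g"
  proof -
    let ?i = "inv\<^bsub>thompson_F\<^esub> f"
    have "g \<circ>\<^sub>F ?i = ?i \<circ>\<^sub>F (f \<circ>\<^sub>F g) \<circ>\<^sub>F ?i" using assms by (simp flip: thompson.m_assoc)
    also have "\<dots> = ?i \<circ>\<^sub>F (g \<circ>\<^sub>F f) \<circ>\<^sub>F ?i" by (simp only: assms(3))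
    also have "\<dots> = ?i \<circ>\<^sub>F g" using assms(1,2) by (simp add: thompson.m_assoc)
    finally show ?thesis .
  qed
  then have "g \<circ>\<^sub>F (inv\<^bsub>thompson_F\<^esub> f \<circ>\<^sub>F f ^\<^sub>F n) = inv\<^bsub>thompson_F\<^esub> f \<circ>\<^sub>F (g \<circ>\<^sub>F f ^\<^sub>F n)"
    using assms by (simp flip: thompson.m_assoc)
  then show ?case using assms pred by (simp add: thompson.m_assoc)
qed

section \<open>Germs at fixed points\<close>

text \<open>Fixing \<open>u\<close> with right-hand slope \<open>2 powi k\<close> there. Recording
  the exponent instead of the slope makes composition additive.\<close>

definition germ :: "real \<Rightarrow> (real \<Rightarrow> real) \<Rightarrow> int \<Rightarrow> bool" where
  "germ u f k \<longleftrightarrow> (\<exists>d>0. \<forall>x. u \<le> x \<and> x \<le> u + d \<longrightarrow> f x = u + 2 powi k * (x - u))"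

lemma germ_exists:
  assumes f: "f \<in> PL2" and u: "0 \<le> u" "u < 1" "f u = u"
  obtains k where "germ u f k"
proof -
  obtain B where B: "finite B" "B \<subseteq> dyadics" "breakpoints_in B f" by (rule PL2_breakpoints[OF f])
  obtain z where z: "u < z" "z \<le> 1" "{u<..<z} \<inter> B = {}" by (rule gap_right[OF B(1) u(2)])
  obtain k where k: "\<And>x. u \<le> x \<Longrightarrow> x \<le> z \<Longrightarrow> f x = f u + 2 powi (k::int) * (x - u)"
    by (rule breakpoints_in_closed[OF B(3) u(1) z(1,2,3) PL2_cont[OF f]]) blast
  have "f x = u + 2 powi k * (x - u)" if "u \<le> x" "x \<le> z" for x
    using k[OF that] by (simp only: u(3))
  then have "germ u f k" unfolding germ_def
    by (intro exI[of _ "z - u"]) (use z in auto)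
  then show thesis by (rule that)
qed

text \<open>The counterpart at 1 of a germ at 0, anchored at the fixed point 1.\<close>

lemma left_slope_at_1:
  assumes f: "f \<in> PL2"
  obtains d k where "0 < d" "d \<le> 1" "\<And>x. 1 - d \<le> x \<Longrightarrow> x \<le> 1 \<Longrightarrow> f x = 1 - 2 powi (k::int) * (1 - x)"
proof -
  obtain B where B: "finite B" "B \<subseteq> dyadics" "breakpoints_in B f" by (rule PL2_breakpoints[OF f])
  obtain z :: real where z: "0 \<le> z" "z < 1" "{z<..<1} \<inter> B = {}"
    by (rule gap_left[OF B(1), of 0 1]) auto
  obtain k where k: "\<And>x. z \<le> x \<Longrightarrow> x \<le> 1 \<Longrightarrow> f x = f z + 2 powi (k::int) * (x - z)"
    by (rule breakpoints_in_closed[OF B(3) z(1,2) order_refl z(3) PL2_cont[OF f]]) blast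
  have "f x = 1 - 2 powi k * (1 - x)" if "z \<le> x" "x \<le> 1" for x
    using k[of x] k[of 1] that z PL2_1[OF f] by (simp add: algebra_simps)
  then show thesis using z by (intro that[of "1 - z" k]) auto
qed

lemma powi_2_eq_iff: "(2::real) powi k = 2 powi l \<longleftrightarrow> k = l"
  using power_int_strict_increasing[of k l "2::real"] power_int_strict_increasing[of l k "2::real"]
  by (cases k l rule: linorder_cases) auto

text \<open>Compare both linear formulas at one point to the right of \<open>u\<close> that lies in
  all three intervals.\<close>

lemma germ_unique:
  assumes "germ u f k" "germ u g l" "u < v" "\<And>x. u \<le> x \<Longrightarrow> x \<le> v \<Longrightarrow> f x = g x"
  shows "k = l"
proof -
  obtain d where d: "d > 0" "\<And>x. u \<le> x \<Longrightarrow> x \<le> u + d \<Longrightarrow> f x = u + 2 powi k * (x - u)"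
    using assms(1) unfolding germ_def by blast
  obtain e where e: "e > 0" "\<And>x. u \<le> x \<Longrightarrow> x \<le> u + e \<Longrightarrow> g x = u + 2 powi l * (x - u)"
    using assms(2) unfolding germ_def by blast
  define x where "x = min v (u + min d e)"
  have x: "u < x" "x \<le> v" "x \<le> u + d" "x \<le> u + e"
    using d(1) e(1) assms(3) by (auto simp: x_def)
  then have "2 powi k * (x - u) = 2 powi l * (x - u)"
    using d(2)[of x] e(2)[of x] assms(4)[of x] by simp
  then show ?thesis using x by (simp add: powi_2_eq_iff)
qed

lemma germ_one:
  assumes "0 \<le> u" "u < 1"
  shows "germ u \<one>\<^bsub>thompson_F\<^esub> 0"
  unfolding germ_def by (intro exI[of _ "1 - u"]) (use assms in auto)

lemma germ_fixed: "germ u f k \<Longrightarrow> f u = u"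
  unfolding germ_def by (metis add.right_neutral diff_self less_add_same_cancel1 linorder_not_less mult_zero_right nle_le)

text \<open>Slopes multiply under composition, so their exponents add.\<close>

lemma germ_mult:
  assumes "0 \<le> u" "u < 1" "germ u f k" "germ u g l"
  shows "germ u (f \<circ>\<^sub>F g) (k + l)"
proof -
  obtain d where d: "d > 0" "\<And>x. u \<le> x \<Longrightarrow> x \<le> u + d \<Longrightarrow> f x = u + 2 powi k * (x - u)"
    using assms(3) unfolding germ_def by blast
  obtain e where e: "e > 0" "\<And>x. u \<le> x \<Longrightarrow> x \<le> u + e \<Longrightarrow> g x = u + 2 powi l * (x - u)"
    using assms(4) unfolding germ_def by blast
  \<comment> \<open>The bound \<open>d / 2 powi l\<close> makes \<open>g x\<close> land where
    \<open>f\<close> is known to be linear; \<open>1 - u\<close> keeps \<open>x\<close> in the unit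
    interval.\<close>
  define r where "r = min (1 - u) (min e (d / 2 powi l))"
  have r: "0 < r" "r \<le> 1 - u" "r \<le> e" "r \<le> d / 2 powi l" using assms d e by (auto simp: r_def)
  show ?thesis unfolding germ_def
  proof (rule exI[of _ r], intro conjI allI impI)
    fix x assume "u \<le> x \<and> x \<le> u + r"
    then have x: "u \<le> x" "x \<le> u + r" by auto
    have "2 powi l * (x - u) \<le> 2 powi l * (d / 2 powi l)"
      by (rule mult_left_mono) (use x r in auto)
    then have "2 powi l * (x - u) \<le> d" by simp
    moreover have "0 \<le> 2 powi l * (x - u)" using x by simp
    ultimately have "f (u + 2 powi l * (x - u)) = u + 2 powi k * (2 powi l * (x - u))"
      using d(2)[of "u + 2 powi l * (x - u)"] by simp
    then show "(f \<circ>\<^sub>F g) x = u + 2 powi (k + l) * (x - u)"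
      using e(2)[of x] x r assms by (simp add: power_int_add mult.assoc)
  qed (use r in simp)
qed

text \<open>The inverse has some germ because it fixes \<open>u\<close>; its exponent is forced, as
  the product with \<open>f\<close> is the identity, of exponent 0.\<close>

lemma germ_inv:
  assumes f: "f \<in> PL2" and u: "0 \<le> u" "u < 1" and k: "germ u f k"
  shows "germ u (inv\<^bsub>thompson_F\<^esub> f) (- k)"
proof -
  have "(inv\<^bsub>thompson_F\<^esub> f) u = u"
    using inv_F_apply(1)[OF f, of u] germ_fixed[OF k] u by simp
  then obtain l where l: "germ u (inv\<^bsub>thompson_F\<^esub> f) l"
    using germ_exists[of "inv\<^bsub>thompson_F\<^esub> f" u] f u by blast
  have "germ u \<one>\<^bsub>thompson_F\<^esub> (l + k)"
    using germ_mult[OF u l k] f by simp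
  then have "l + k = 0" using germ_unique[OF _ germ_one[OF u]] u by blast
  then have "l = - k" by simp
  with l show ?thesis by simp
qed

lemma germ_pow:
  assumes f: "f \<in> PL2" and u: "0 \<le> u" "u < 1" and k: "germ u f k"
  shows "germ u (f ^\<^sub>F n) (n * k)"
  using f
proof (induction rule: pow_F_induct[where P = "\<lambda>n h. germ u h (n * k)"])
  case zero
  then show ?case using germ_one[OF u] by simp
next
  case (succ n)
  then show ?case using germ_mult[OF u k succ] by (simp add: algebra_simps)
next
  case (pred n)
  then show ?case using germ_mult[OF u germ_inv[OF f u k] pred] by (simp add: algebra_simps)
qed

section \<open>Centralizers of one-bump maps\<close>

text \<open>A map pushing all of the open interval towards \<open>u\<close>. With slope 1/2 at
  \<open>u\<close>, its powers realise every power of two as a slope there, so any germ at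
  \<open>u\<close> can be cancelled by a power of \<open>b\<close>.\<close>

locale bump =
  fixes b :: "real \<Rightarrow> real" and u v :: real
  assumes PL2: "b \<in> PL2" and bounds: "0 \<le> u" "u < v" "v \<le> 1"
    and fixed: "b u = u" "b v = v" and below: "\<And>x. u < x \<Longrightarrow> x < v \<Longrightarrow> b x < x"
    and germ: "germ u b (-1)"
begin

lemma pow_mem:
  assumes "u < x" "x < v"
  shows "u < (b ^\<^sub>F n) x" "(b ^\<^sub>F n) x < v"
  using PL2_strict_mono[OF pow_F_closed[OF PL2], of u x n] PL2_strict_mono[OF pow_F_closed[OF PL2], of x v n]
    pow_F_fixed[OF PL2, of u n] pow_F_fixed[OF PL2, of v n] assms bounds fixed by auto

lemma pow_lt:
  assumes "u < x" "x < v" "m < n"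
  shows "(b ^\<^sub>F n) x < (b ^\<^sub>F m) x"
  using assms(3)
proof (induction n rule: int_gr_induct)
  have suc: "(b ^\<^sub>F (i + 1)) x < (b ^\<^sub>F i) x" for i
    using pow_F_add_apply[OF PL2, of x 1 i] PL2 below pow_mem[OF assms(1,2)] bounds assms(1,2)
    by (simp add: add.commute)
  case base
  show ?case by (rule suc)
next
  case (step i)
  have suc: "(b ^\<^sub>F (i + 1)) x < (b ^\<^sub>F i) x" for i
    using pow_F_add_apply[OF PL2, of x 1 i] PL2 below pow_mem[OF assms(1,2)] bounds assms(1,2)
    by (simp add: add.commute)
  show ?case using suc[of i] step by linarith
qed

lemma pow_le:
  assumes "u < x" "x < v" "m \<le> n"
  shows "(b ^\<^sub>F n) x \<le> (b ^\<^sub>F m) x"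
  using pow_lt[OF assms(1,2), of m n] assms(3) by (cases "m = n") auto

text \<open>The forward orbit decreases and is bounded below by \<open>u\<close>, so it converges.
  By continuity the limit is a fixed point, and \<open>u\<close> is the only fixed point left of
  \<open>v\<close> in the interval.\<close>

lemma pow_attracted:
  assumes x: "u < x" "x < v" and w: "u < w"
  obtains n :: nat where "(b ^\<^sub>F int n) x < w"
proof -
  define y where "y n = (b ^\<^sub>F int n) x" for n :: nat
  have y: "u < y n" "y n < v" for n using pow_mem[OF x] by (simp_all add: y_def)
  have dec: "decseq y"
    unfolding decseq_def y_def using pow_le[OF x] by simp
  obtain L where L: "y \<longlonglongrightarrow> L" "\<And>n. L \<le> y n"
    using decseq_convergent[OF dec, of u] y less_imp_le by metis
  have "u \<le> L" using LIMSEQ_le_const[OF L(1), of u] y less_imp_le by blast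
  have "L < v" using L(2)[of 0] y(2)[of 0] by linarith
  have "continuous (at L within {0..1}) b"
    using PL2_cont[OF PL2] \<open>u \<le> L\<close> \<open>L < v\<close> bounds by (auto simp: continuous_on_eq_continuous_within)
  then have "(\<lambda>n. b (y n)) \<longlonglongrightarrow> b L"
    using L(1) y bounds unfolding continuous_within_sequentially comp_def
    by (metis (no_types, lifting) atLeastAtMost_iff dual_order.trans less_imp_le)
  moreover have "b (y n) = y (Suc n)" for n
    using pow_F_add_apply[OF PL2, of x 1 "int n"] PL2 x bounds by (simp add: y_def)
  ultimately have "b L = L" using LIMSEQ_Suc[OF L(1)] LIMSEQ_unique by auto
  then have "L = u" using below[of L] \<open>u \<le> L\<close> \<open>L < v\<close> by fastforce
  then have "eventually (\<lambda>n. y n < w) sequentially"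
    using L(1) w order_tendstoD(2) by blast
  then obtain n where "y n < w" by (auto simp: eventually_sequentially)
  then show thesis using that by (simp add: y_def)
qed

text \<open>A commuting map with trivial germ at \<open>u\<close> is the identity near \<open>u\<close>, and powers of \<open>b\<close> carry every
  point of the interval into that neighbourhood.\<close>

lemma commuting_trivial_germ:
  assumes g: "g \<in> PL2" "g \<circ>\<^sub>F b = b \<circ>\<^sub>F g" "germ u g 0" and x: "u \<le> x" "x < v"
  shows "g x = x"
proof (cases "x = u")
  case True
  then show ?thesis using germ_fixed[OF g(3)] by simp
next
  case False
  then have x: "u < x" "x < v" "x \<in> {0..1}" using x bounds by auto
  obtain d where d: "d > 0" "\<And>x. u \<le> x \<Longrightarrow> x \<le> u + d \<Longrightarrow> g x = x"
    using g(3) unfolding germ_def by auto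
  obtain n :: nat where n: "(b ^\<^sub>F int n) x < u + d"
    by (rule pow_attracted[OF x(1,2), of "u + d"]) (use d in auto)
  let ?c = "b ^\<^sub>F int n"
  have "g (?c x) = ?c x" using d(2)[of "?c x"] n pow_mem(1)[OF x(1,2), of "int n"] by simp
  moreover have "g (?c x) = ?c (g x)"
    using fun_cong[OF pow_F_commute[OF PL2 g(1,2), of "int n"], of x] x(3) by simp
  ultimately have "?c (g x) = ?c x" by simp
  then show ?thesis
    using inj_onD[OF PL2_inj[OF pow_F_closed[OF PL2]], of "int n" "g x" x] PL2_range[OF g(1) x(3)] x(3) by blast
qed

text \<open>If \<open>g\<close> has exponent \<open>l\<close> at \<open>u\<close>, then
  \<open>b ^\<^sub>F l\<close> has exponent \<open>- l\<close>, so their product commutes with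
  \<open>b\<close> and has trivial germ. It is therefore the identity on the interval, and
  \<open>g\<close> agrees there with the power \<open>- l\<close>.\<close>

lemma centralizer:
  assumes g: "g \<in> PL2" "g \<circ>\<^sub>F b = b \<circ>\<^sub>F g" "g u = u"
  obtains k where "\<And>x. u \<le> x \<Longrightarrow> x < v \<Longrightarrow> g x = (b ^\<^sub>F k) x"
proof -
  have u: "0 \<le> u" "u < 1" using bounds by auto
  obtain l where l: "germ u g l" by (rule germ_exists[OF g(1) u g(3)])
  let ?c = "b ^\<^sub>F l"
  have "germ u (?c \<circ>\<^sub>F g) (l * (-1) + l)" by (rule germ_mult[OF u germ_pow[OF PL2 u germ] l])
  then have "germ u (?c \<circ>\<^sub>F g) 0" by simp
  moreover have "(?c \<circ>\<^sub>F g) \<circ>\<^sub>F b = b \<circ>\<^sub>F (?c \<circ>\<^sub>F g)"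
  proof -
    have "?c \<circ>\<^sub>F b = b \<circ>\<^sub>F ?c" using pow_F_commute[OF PL2 PL2, of l] by simp
    then have "b \<circ>\<^sub>F (?c \<circ>\<^sub>F g) = ?c \<circ>\<^sub>F (b \<circ>\<^sub>F g)"
      using PL2 g by (simp flip: thompson.m_assoc)
    then show ?thesis using PL2 g by (simp add: thompson.m_assoc)
  qed
  ultimately have id: "(?c \<circ>\<^sub>F g) x = x" if "u \<le> x" "x < v" for x
    using commuting_trivial_germ[of "?c \<circ>\<^sub>F g" x] that PL2 g by blast
  have "g x = (b ^\<^sub>F (- l)) x" if x: "u \<le> x" "x < v" for x
  proof -
    have x01: "x \<in> {0..1}" using x bounds by auto
    then have "?c (g x) = x" using id[OF x] by simp
    then show ?thesis using pow_F_cancel(1)[OF PL2 PL2_range[OF g(1) x01], of l] by simp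
  qed
  then show thesis by (rule that)
qed

end

section \<open>The two generators\<close>

text \<open>A convex map with slopes 1/2, 1 and 2, hence a maximum of three affine functions; this
  form makes continuity immediate.\<close>

definition slide :: "real \<Rightarrow> real" where
  "slide = (\<lambda>x\<in>{0..1}. max (x / 2) (max (x - 1 / 4) (2 * x - 1)))"

text \<open>The inner maximum is the graph of \<open>slide\<close> scaled by 1/4 into the square
  over \<open>[1/2, 3/4]\<close>; the minimum with \<open>x\<close> gives the identity
  outside.\<close>

definition wave :: "real \<Rightarrow> real" where
  "wave = (\<lambda>x\<in>{0..1}. min x (max (x / 2 + 1 / 4) (max (x - 1 / 16) (2 * x - 3 / 4))))"

text \<open>Surjectivity comes from the intermediate value theorem once both end points are
  fixed.\<close>

lemma PL2_I_endpoints: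
  assumes "f \<in> extensional {0..1}" "mono_on {0..1} f" "continuous_on {0..1} f" "f 0 = 0" "f 1 = 1"
    "finite B" "B \<subseteq> dyadics" "breakpoints_in B f"
  shows "f \<in> PL2"
proof (rule PL2_I[OF assms(1) _ assms(2,6,7,8,3)])
  show "f ` {0..1} = {0..1}"
  proof (intro equalityI subsetI)
    fix y assume "y \<in> f ` {0..1}"
    then obtain x where "x \<in> {0..1}" "y = f x" by blast
    then show "y \<in> {0..1}"
      using mono_onD[OF assms(2), of 0 x] mono_onD[OF assms(2), of x 1] assms(4,5) by auto
  next
    fix y :: real assume "y \<in> {0..1}"
    then obtain x where "0 \<le> x" "x \<le> 1" "f x = y"
      using IVT'[of f 0 y 1] assms by auto
    then show "y \<in> f ` {0..1}" by auto
  qed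
qed

lemma dyadics_numeral_divide: "real m / 2 ^ k \<in> dyadics"
  unfolding dyadics_def by blast

lemma slide_PL2: "slide \<in> PL2"
proof (rule PL2_I_endpoints[where B = "{1/2, 3/4}"])
  show "continuous_on {0..1} slide" unfolding slide_def
    by (rule continuous_on_eq[of _ "\<lambda>x. max (x / 2) (max (x - 1 / 4) (2 * x - 1))"])
      (auto intro!: continuous_intros)
  show "{1/2, 3/4} \<subseteq> (dyadics :: real set)"
    using dyadics_numeral_divide[of 1 1] dyadics_numeral_divide[of 3 2] by simp
  show "breakpoints_in {1/2, 3/4} slide"
    unfolding breakpoints_in_def
  proof (intro allI impI)
    fix p q :: real
    assume pq: "0 \<le> p \<and> p < q \<and> q \<le> 1 \<and> {p<..<q} \<inter> {1/2, 3/4} = {}"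
    then consider "q \<le> 1/2" | "1/2 \<le> p" "q \<le> 3/4" | "3/4 \<le> p" by force
    then show "\<exists>k c. \<forall>x\<in>{p<..<q}. slide x = 2 powi k * x + c"
    proof cases
      case 1
      then have "\<forall>x\<in>{p<..<q}. slide x = 2 powi (- 1) * x + 0"
        using pq by (auto simp: slide_def max_def)
      then show ?thesis by blast
    next
      case 2
      then have "\<forall>x\<in>{p<..<q}. slide x = 2 powi 0 * x + (- 1 / 4)"
        using pq by (auto simp: slide_def max_def)
      then show ?thesis by blast
    next
      case 3
      then have "\<forall>x\<in>{p<..<q}. slide x = 2 powi 1 * x + (- 1)"
        using pq by (auto simp: slide_def max_def)
      then show ?thesis by blast
    qed
  qed
qed (auto simp: slide_def max_def intro!: mono_onI)

lemma wave_PL2: "wave \<in> PL2"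
proof (rule PL2_I_endpoints[where B = "{1/2, 5/8, 11/16, 3/4}"])
  show "continuous_on {0..1} wave" unfolding wave_def
    by (rule continuous_on_eq[of _ "\<lambda>x. min x (max (x / 2 + 1 / 4) (max (x - 1 / 16) (2 * x - 3 / 4)))"])
      (auto intro!: continuous_intros)
  show "{1/2, 5/8, 11/16, 3/4} \<subseteq> (dyadics :: real set)"
    using dyadics_numeral_divide[of 1 1] dyadics_numeral_divide[of 3 2]
      dyadics_numeral_divide[of 5 3] dyadics_numeral_divide[of 11 4] by simp
  show "breakpoints_in {1/2, 5/8, 11/16, 3/4} wave"
    unfolding breakpoints_in_def
  proof (intro allI impI)
    fix p q :: real
    assume pq: "0 \<le> p \<and> p < q \<and> q \<le> 1 \<and> {p<..<q} \<inter> {1/2, 5/8, 11/16, 3/4} = {}"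
    then consider "q \<le> 1/2 \<or> 3/4 \<le> p" | "1/2 \<le> p" "q \<le> 5/8" | "5/8 \<le> p" "q \<le> 11/16"
      | "11/16 \<le> p" "q \<le> 3/4" by force
    then show "\<exists>k c. \<forall>x\<in>{p<..<q}. wave x = 2 powi k * x + c"
    proof cases
      case 1
      then have "\<forall>x\<in>{p<..<q}. wave x = 2 powi 0 * x + 0"
        using pq by (auto simp: wave_def max_def min_def)
      then show ?thesis by blast
    next
      case 2
      then have "\<forall>x\<in>{p<..<q}. wave x = 2 powi (- 1) * x + 1 / 4"
        using pq by (auto simp: wave_def max_def min_def)
      then show ?thesis by blast
    next
      case 3
      then have "\<forall>x\<in>{p<..<q}. wave x = 2 powi 0 * x + (- 1 / 16)"
        using pq by (auto simp: wave_def max_def min_def)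
      then show ?thesis by blast
    next
      case 4
      then have "\<forall>x\<in>{p<..<q}. wave x = 2 powi 1 * x + (- 3 / 4)"
        using pq by (auto simp: wave_def max_def min_def)
      then show ?thesis by blast
    qed
  qed
qed (auto simp: wave_def max_def min_def intro!: mono_onI)

interpretation slide: bump slide 0 1
proof
  show "germ 0 slide (- 1)" unfolding germ_def
    by (intro exI[of _ "1/2"]) (auto simp: slide_def max_def)
qed (use slide_PL2 in \<open>auto simp: slide_def max_def\<close>)

interpretation wave: bump wave "1/2" "3/4"
proof
  show "germ (1/2) wave (- 1)" unfolding germ_def
    by (intro exI[of _ "1/8"]) (auto simp: wave_def max_def min_def field_simps)
qed (use wave_PL2 in \<open>auto simp: wave_def max_def min_def\<close>)

section \<open>Centralizers of \<open>slide\<close> and \<open>wave\<close>\<close>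

lemma wave_moves_iff: "x \<in> {0..1} \<Longrightarrow> wave x = x \<longleftrightarrow> x \<notin> {1/2<..<3/4}"
  by (auto simp: wave_def max_def min_def)

lemma slide_three_quarters: "slide (3/4) = 1/2"
  by (simp add: slide_def)

text \<open>The left end of tile \<open>n\<close> is the right end of tile \<open>n + 1\<close>:
  tiles move left as the index grows.\<close>

lemma slide_pow_half: "(slide ^\<^sub>F n) (1/2) = (slide ^\<^sub>F (n + 1)) (3/4)"
  using pow_F_add_apply[OF slide_PL2, of "3/4" n 1] slide_PL2 slide_three_quarters by simp

lemma slide_pow_mono:
  "x \<in> {0..1} \<Longrightarrow> y \<in> {0..1} \<Longrightarrow> x \<le> y \<Longrightarrow> (slide ^\<^sub>F n) x \<le> (slide ^\<^sub>F n) y"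
  using PL2_le_iff[OF pow_F_closed[OF slide_PL2]] by blast

text \<open>Every element of F fixes 0, so the bump centralizer applies on \<open>[0,1)\<close>; the
  remaining point 1 is fixed by both sides.\<close>

lemma slide_centralizer:
  assumes g: "g \<in> PL2"
  shows "g \<circ>\<^sub>F slide = slide \<circ>\<^sub>F g \<longleftrightarrow> (\<exists>k. g = slide ^\<^sub>F k)"
proof
  assume "g \<circ>\<^sub>F slide = slide \<circ>\<^sub>F g"
  then obtain k where k: "\<And>x. 0 \<le> x \<Longrightarrow> x < 1 \<Longrightarrow> g x = (slide ^\<^sub>F k) x"
    using slide.centralizer[OF g _ PL2_0[OF g]] by blast
  have "g x = (slide ^\<^sub>F k) x" if "x \<in> {0..1}" for x
    using k[of x] PL2_1[OF g] PL2_1[OF pow_F_closed[OF slide_PL2], of k] that by (cases "x = 1") auto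
  then have "g = slide ^\<^sub>F k"
    using g slide_PL2 by (intro PL2_eqI) auto
  then show "\<exists>k. g = slide ^\<^sub>F k" by blast
next
  assume "\<exists>k. g = slide ^\<^sub>F k"
  then show "g \<circ>\<^sub>F slide = slide \<circ>\<^sub>F g"
    using pow_F_commute[OF slide_PL2 slide_PL2 refl] by metis
qed

lemma wave_pow_ends: "(wave ^\<^sub>F k) (1/2) = 1/2" "(wave ^\<^sub>F k) (3/4) = 3/4"
  by (rule pow_F_fixed[OF wave_PL2]; use wave.fixed in auto)+

text \<open>A commuting map carries moved points to moved points: if \<open>wave\<close> fixed
  \<open>g x\<close>, injectivity of \<open>g\<close> would make it fix \<open>x\<close>.\<close>

lemma wave_commuting_maps_support:
  assumes g: "g \<in> PL2" "g \<circ>\<^sub>F wave = wave \<circ>\<^sub>F g" and x: "x \<in> {1/2<..<3/4}"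
  shows "g x \<in> {1/2<..<3/4}"
proof (rule ccontr)
  assume contra: "g x \<notin> {1/2<..<3/4}"
  have x01: "x \<in> {0..1}" using x by auto
  have "g (wave x) = g x"
    using fun_cong[OF g(2), of x] contra x01 wave_moves_iff[OF PL2_range[OF g(1) x01]] by simp
  then have "wave x = x"
    using inj_onD[OF PL2_inj[OF g(1)]] x01 PL2_range[OF wave_PL2 x01] by blast
  then show False using wave_moves_iff[OF x01] x by simp
qed

text \<open>If an end point were pushed out of the tile, so would be some interior point near it,
  against \<open>wave_commuting_maps_support\<close>.\<close>

lemma wave_commuting_bounds:
  assumes g: "g \<in> PL2" "g \<circ>\<^sub>F wave = wave \<circ>\<^sub>F g"
  shows "g (3/4) \<le> 3/4" "1/2 \<le> g (1/2)"
proof -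
  have pre: "\<exists>y\<in>{0..1}. g y = c" if "c \<in> {0..1}" for c
    using PL2_image[OF g(1)] that by (metis imageE)
  show "g (3/4) \<le> 3/4"
  proof (rule ccontr)
    assume "\<not> g (3/4) \<le> 3/4"
    moreover obtain y where y: "y \<in> {0..1}" "g y = 3/4" using pre[of "3/4"] by auto
    ultimately have "y < 3/4" using PL2_less_iff[OF g(1) y(1), of "3/4"] by simp
    \<comment> \<open>A point of the open tile beyond the preimage \<open>y\<close> of
      \<open>3/4\<close>; its image would exceed \<open>3/4\<close>.\<close>
    define z where "z = (max y (1/2) + 3/4) / 2"
    have z: "z \<in> {1/2<..<3/4}" "y < z" using \<open>y < 3/4\<close> by (auto simp: z_def)
    then have "g y < g z" using PL2_less_iff[OF g(1) y(1), of z] by auto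
    then show False using wave_commuting_maps_support[OF g z(1)] y by simp
  qed
  show "1/2 \<le> g (1/2)"
  proof (rule ccontr)
    assume "\<not> 1/2 \<le> g (1/2)"
    moreover obtain y where y: "y \<in> {0..1}" "g y = 1/2" using pre[of "1/2"] by auto
    ultimately have "1/2 < y" using PL2_less_iff[OF g(1) _ y(1), of "1/2"] by simp
    define z where "z = (min y (3/4) + 1/2) / 2"
    have z: "z \<in> {1/2<..<3/4}" "z < y" using \<open>1/2 < y\<close> by (auto simp: z_def)
    then have "g z < g y" using PL2_less_iff[OF g(1) _ y(1), of z] by auto
    then show False using wave_commuting_maps_support[OF g z(1)] y by simp
  qed
qed

text \<open>Applying the bounds to \<open>g\<close> and to its inverse shows that \<open>g\<close>
  fixes both ends of the tile, as the bump centralizer requires at the left end.\<close>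

lemma wave_centralizer:
  assumes g: "g \<in> PL2" "g \<circ>\<^sub>F wave = wave \<circ>\<^sub>F g"
  obtains k where "\<And>x. x \<in> {1/2..3/4} \<Longrightarrow> g x = (wave ^\<^sub>F k) x"
proof -
  let ?i = "inv\<^bsub>thompson_F\<^esub> g"
  have i: "?i \<in> PL2" "?i \<circ>\<^sub>F wave = wave \<circ>\<^sub>F ?i"
    using pow_F_commute[OF g(1) wave_PL2 g(2)[symmetric], of "- 1"] thompson.int_pow_neg[of g 1] g(1)
    by auto
  have "?i (3/4) \<le> 3/4" "1/2 \<le> ?i (1/2)" by (rule wave_commuting_bounds[OF i])+
  then have "3/4 \<le> g (3/4)" "g (1/2) \<le> 1/2"
    using PL2_le_iff[OF g(1) PL2_range[OF i(1)], of "3/4" "3/4"] PL2_le_iff[OF g(1) _ PL2_range[OF i(1)], of "1/2" "1/2"]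
      inv_F_apply(2)[OF g(1), of "3/4"] inv_F_apply(2)[OF g(1), of "1/2"] by auto
  then have fix_ends: "g (3/4) = 3/4" "g (1/2) = 1/2"
    using wave_commuting_bounds[OF g] by auto
  obtain k where k: "\<And>x. 1/2 \<le> x \<Longrightarrow> x < 3/4 \<Longrightarrow> g x = (wave ^\<^sub>F k) x"
    using wave.centralizer[OF g fix_ends(2)] by blast
  have "g x = (wave ^\<^sub>F k) x" if "x \<in> {1/2..3/4}" for x
  proof (cases "x = 3/4")
    case True
    show ?thesis unfolding True by (simp only: fix_ends wave_pow_ends)
  next
    case False
    then show ?thesis using k[of x] that by simp
  qed
  then show thesis by (rule that)
qed

lemma wave_pow_mem:
  assumes "x \<in> {1/2..3/4}"
  shows "(wave ^\<^sub>F k) x \<in> {1/2..3/4}"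
  using PL2_le_iff[OF pow_F_closed[OF wave_PL2], of "1/2" x k] PL2_le_iff[OF pow_F_closed[OF wave_PL2], of x "3/4" k]
    assms unfolding wave_pow_ends by simp

text \<open>The germ of \<open>wave ^\<^sub>F k\<close> at 1/2 has exponent
  \<open>- k\<close>.\<close>

lemma wave_pow_inject:
  assumes "\<And>x. x \<in> {1/2..3/4} \<Longrightarrow> (wave ^\<^sub>F k) x = (wave ^\<^sub>F l) x"
  shows "k = l"
proof -
  have "k * (- 1) = l * (- 1)"
    by (rule germ_unique[OF germ_pow[OF wave_PL2 _ _ wave.germ] germ_pow[OF wave_PL2 _ _ wave.germ], where v = "3/4"])
      (use assms in auto)
  then show ?thesis by simp
qed

section \<open>Coordinates of the base group\<close>

text \<open>A negative power brings \<open>x\<close> to the right of 1/2. Then \<open>slide\<close>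
  is applied until the value first drops to at most 3/4; since \<open>slide\<close> maps 3/4 to 1/2,
  that step cannot jump over the tile.\<close>

lemma slide_pow_covers:
  assumes "0 < x" "x < 1"
  obtains n where "(slide ^\<^sub>F n) x \<in> {1/2..3/4}"
proof -
  obtain m :: nat where m: "(slide ^\<^sub>F int m) (1/2) < x"
    by (rule slide.pow_attracted[of "1/2" x]) (use assms in auto)
  define y where "y = (slide ^\<^sub>F (- int m)) x"
  have y: "0 < y" "y < 1" using slide.pow_mem assms by (simp_all add: y_def)
  have "1/2 < y"
    using PL2_less_iff[OF pow_F_closed[OF slide_PL2], of "1/2" y "int m"] m y
      pow_F_cancel(2)[OF slide_PL2, of x "int m"] assms by (simp add: y_def)
  obtain j0 :: nat where "(slide ^\<^sub>F int j0) y < 3/4"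
    by (rule slide.pow_attracted[OF y, of "3/4"]) auto
  define j where "j = (LEAST j::nat. (slide ^\<^sub>F int j) y \<le> 3/4)"
  have j: "(slide ^\<^sub>F int j) y \<le> 3/4"
    unfolding j_def by (rule LeastI[where k = j0]) (use \<open>(slide ^\<^sub>F int j0) y < 3/4\<close> in simp)
  have "1/2 \<le> (slide ^\<^sub>F int j) y"
  proof (cases j)
    case 0
    then show ?thesis using \<open>1/2 < y\<close> y by simp
  next
    case (Suc i)
    then have "3/4 < (slide ^\<^sub>F int i) y"
      using not_less_Least[of i "\<lambda>j. (slide ^\<^sub>F int j) y \<le> 3/4"] by (simp add: j_def)
    moreover have "(slide ^\<^sub>F int j) y = slide ((slide ^\<^sub>F int i) y)"
      using pow_F_add_apply[OF slide_PL2, of y 1 "int i"] y slide_PL2 by (simp add: Suc)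
    ultimately show ?thesis
      using PL2_le_iff[OF slide_PL2, of "3/4" "(slide ^\<^sub>F int i) y"] slide_three_quarters
        slide.pow_mem[OF y, of "int i"] by simp
  qed
  with j have "(slide ^\<^sub>F (int j + - int m)) x \<in> {1/2..3/4}"
    using pow_F_add_apply[OF slide_PL2, of x "int j" "- int m"] assms by (simp add: y_def)
  then show thesis by (rule that)
qed

text \<open>With exponent \<open>- n\<close> it transports the action of \<open>g\<close> on tile
  \<open>n\<close> back to the base tile \<open>[1/2, 3/4]\<close>.\<close>

definition conj_slide :: "int \<Rightarrow> (real \<Rightarrow> real) \<Rightarrow> real \<Rightarrow> real" where
  "conj_slide n g = slide ^\<^sub>F n \<circ>\<^sub>F g \<circ>\<^sub>F slide ^\<^sub>F (- n)"

lemma conj_slide_closed [simp, intro]: "g \<in> PL2 \<Longrightarrow> conj_slide n g \<in> PL2"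
  using slide_PL2 by (simp add: conj_slide_def)

lemma conj_slide_apply:
  "g \<in> PL2 \<Longrightarrow> x \<in> {0..1} \<Longrightarrow> conj_slide n g x = (slide ^\<^sub>F n) (g ((slide ^\<^sub>F (- n)) x))"
  using slide_PL2 PL2_range[OF pow_F_closed[OF slide_PL2]] by (simp add: conj_slide_def)

lemma conj_slide_conj_slide:
  assumes "g \<in> PL2"
  shows "conj_slide m (conj_slide n g) = conj_slide (m + n) g"
proof -
  have "slide ^\<^sub>F (- (m + n)) = slide ^\<^sub>F (- n) \<circ>\<^sub>F slide ^\<^sub>F (- m)"
    using pow_F_add[OF slide_PL2, of "- n" "- m"] by (simp add: add.commute)
  then show ?thesis
    using assms slide_PL2 by (simp add: conj_slide_def pow_F_add[OF slide_PL2, of m n] thompson.m_assoc)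
qed

lemma conj_slide_0: "g \<in> PL2 \<Longrightarrow> conj_slide 0 g = g"
  by (simp add: conj_slide_def)

lemma conj_slide_mult:
  assumes "g \<in> PL2" "h \<in> PL2"
  shows "conj_slide n (g \<circ>\<^sub>F h) = conj_slide n g \<circ>\<^sub>F conj_slide n h"
proof (rule PL2_eqI)
  fix x :: real assume "x \<in> {0..1}"
  then show "conj_slide n (g \<circ>\<^sub>F h) x = (conj_slide n g \<circ>\<^sub>F conj_slide n h) x"
    using assms PL2_range pow_F_cancel(1)[OF slide_PL2, of _ n] slide_PL2
    by (simp add: conj_slide_apply PL2_range[OF pow_F_closed] del: atLeastAtMost_iff)
qed (use assms in simp_all)

text \<open>The intervals \<open>slide\<^sup>n [1/2, 3/4]\<close> tile \<open>(0,1)\<close>; coordinate \<open>n\<close> is the exponent of \<open>wave\<close> on the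
  \<open>n\<close>-th tile.\<close>

definition coords :: "(real \<Rightarrow> real) \<Rightarrow> (int \<Rightarrow> int) \<Rightarrow> bool" where
  "coords g \<phi> \<longleftrightarrow> (\<forall>n. \<forall>x\<in>{1/2..3/4}. conj_slide (- n) g x = (wave ^\<^sub>F \<phi> n) x)"

lemma coordsD: "coords g \<phi> \<Longrightarrow> x \<in> {1/2..3/4} \<Longrightarrow> conj_slide (- n) g x = (wave ^\<^sub>F \<phi> n) x"
  by (simp add: coords_def)

text \<open>The tiles cover \<open>(0,1)\<close>, and 0 and 1 are always fixed.\<close>

lemma coords_unique_map:
  assumes g: "g \<in> PL2" "coords g \<phi>" and h: "h \<in> PL2" "coords h \<phi>"
  shows "g = h"
proof (rule PL2_eqI[OF g(1) h(1)])
  fix x :: real assume x: "x \<in> {0..1}"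
  show "g x = h x"
  proof (cases "x = 0 \<or> x = 1")
    case True
    then show ?thesis using PL2_0[OF g(1)] PL2_1[OF g(1)] PL2_0[OF h(1)] PL2_1[OF h(1)] by metis
  next
    case False
    then have "0 < x" "x < 1" using x by auto
    then obtain n where n: "(slide ^\<^sub>F n) x \<in> {1/2..3/4}" by (rule slide_pow_covers)
    let ?y = "(slide ^\<^sub>F n) x"
    have y: "?y \<in> {0..1}" using n by auto
    \<comment> \<open>As the power \<open>n\<close> carries \<open>x\<close> to the base tile,
      \<open>x\<close> itself lies in tile \<open>- n\<close>, so coordinate \<open>- n\<close> is
      the relevant one.\<close>
    have "conj_slide n g ?y = conj_slide n h ?y"
      using coordsD[OF g(2) n, of "- n"] coordsD[OF h(2) n, of "- n"] by simp
    then have "(slide ^\<^sub>F n) (g x) = (slide ^\<^sub>F n) (h x)"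
      using pow_F_cancel(1)[OF slide_PL2 x, of n] y by (simp add: conj_slide_apply g h)
    then show ?thesis
      using inj_onD[OF PL2_inj[OF pow_F_closed[OF slide_PL2, of n]]] PL2_range[OF g(1) x] PL2_range[OF h(1) x]
      by blast
  qed
qed

lemma coords_unique_fun:
  assumes "coords g \<phi>" "coords g \<psi>"
  shows "\<phi> = \<psi>"
proof
  fix n show "\<phi> n = \<psi> n"
    by (rule wave_pow_inject) (use coordsD[OF assms(1), of _ n] coordsD[OF assms(2), of _ n] in simp)
qed

text \<open>Powers of \<open>wave\<close> preserve the base tile, so exponents add tile by
  tile.\<close>

lemma coords_mult:
  assumes g: "g \<in> PL2" "coords g \<phi>" and h: "h \<in> PL2" "coords h \<psi>"
  shows "coords (g \<circ>\<^sub>F h) (\<lambda>n. \<phi> n + \<psi> n)"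
  unfolding coords_def
proof (intro allI ballI)
  fix n x assume x: "x \<in> {1/2..3/4::real}"
  then have x01: "x \<in> {0..1}" by auto
  have "conj_slide (- n) (g \<circ>\<^sub>F h) x = conj_slide (- n) g (conj_slide (- n) h x)"
    using x01 by (simp add: conj_slide_mult g h)
  also have "\<dots> = (wave ^\<^sub>F \<phi> n) ((wave ^\<^sub>F \<psi> n) x)"
    using coordsD[OF h(2) x] coordsD[OF g(2) wave_pow_mem[OF x]] by simp
  finally show "conj_slide (- n) (g \<circ>\<^sub>F h) x = (wave ^\<^sub>F (\<phi> n + \<psi> n)) x"
    using pow_F_add_apply[OF wave_PL2 x01] by simp
qed

text \<open>Conjugation by \<open>slide\<close> becomes the shift of coordinates, the action
  defining \<open>Z_wr_Z\<close>.\<close>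

lemma coords_conj_slide:
  assumes g: "g \<in> PL2" "coords g \<phi>"
  shows "coords (conj_slide m g) (\<lambda>n. \<phi> (n - m))"
  unfolding coords_def using g coordsD[OF g(2), of _ "_ - m"]
  by (simp add: conj_slide_conj_slide)

text \<open>Positive powers push the right end 3/4 to at most 1/2, negative ones push the left end
  1/2 to at least 3/4.\<close>

lemma slide_pow_tile_disjoint:
  assumes "x \<in> {1/2..3/4}" "n \<noteq> 0"
  shows "(slide ^\<^sub>F n) x \<notin> {1/2<..<3/4}"
proof (cases "n > 0")
  case True
  have "(slide ^\<^sub>F n) x \<le> (slide ^\<^sub>F n) (3/4)" by (rule slide_pow_mono) (use assms in auto)
  also have "\<dots> \<le> (slide ^\<^sub>F 1) (3/4)" by (rule slide.pow_le) (use True in auto)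
  also have "\<dots> = 1/2" using slide_PL2 slide_three_quarters by simp
  finally show ?thesis by auto
next
  case False
  have "3/4 = (slide ^\<^sub>F (- 1)) (1/2)" using slide_pow_half[of "- 1"] by simp
  also have "\<dots> \<le> (slide ^\<^sub>F n) (1/2)" by (rule slide.pow_le) (use False assms in auto)
  also have "\<dots> \<le> (slide ^\<^sub>F n) x" by (rule slide_pow_mono) (use assms in auto)
  finally show ?thesis by auto
qed

lemma coords_wave_pow: "coords (wave ^\<^sub>F k) (\<lambda>n. if n = 0 then k else 0)"
  unfolding coords_def
proof (intro allI ballI)
  fix n x assume x: "x \<in> {1/2..3/4::real}"
  then have x01: "x \<in> {0..1}" by auto
  show "conj_slide (- n) (wave ^\<^sub>F k) x = (wave ^\<^sub>F (if n = 0 then k else 0)) x"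
  proof (cases "n = 0")
    case True
    then show ?thesis using wave_PL2 by (simp add: conj_slide_0)
  next
    case False
    let ?y = "(slide ^\<^sub>F n) x"
    have y: "?y \<in> {0..1}" using PL2_range[OF pow_F_closed[OF slide_PL2] x01] .
    then have "(wave ^\<^sub>F k) ?y = ?y"
      using pow_F_fixed[OF wave_PL2 y] wave_moves_iff[OF y] slide_pow_tile_disjoint[OF x False] by blast
    then show ?thesis
      using False x01 wave_PL2 pow_F_cancel(1)[OF slide_PL2 x01, of n] by (simp add: conj_slide_apply)
  qed
qed

text \<open>Multiply together one conjugated power of \<open>wave\<close> for each tile in the
  support.\<close>

lemma coords_exist:
  assumes "finite {n. \<phi> n \<noteq> 0}"
  obtains g where "g \<in> PL2" "coords g \<phi>"
proof -
  \<comment> \<open>Allowing any finite superset \<open>S\<close> of the support lets the induction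
    clear one coordinate at a time.\<close>
  have "\<exists>g\<in>PL2. coords g \<phi>" if "finite S" "{n. \<phi> n \<noteq> 0} \<subseteq> S" for S
    using that
  proof (induction S arbitrary: \<phi> rule: finite_induct)
    case empty
    then have "coords (wave ^\<^sub>F 0) \<phi>"
      using coords_wave_pow[of 0] by (simp add: coords_def)
    then show ?case using wave_PL2 by blast
  next
    case (insert m S)
    have "{n. (\<phi>(m := 0)) n \<noteq> 0} \<subseteq> S" using insert.prems by auto
    then obtain g where g: "g \<in> PL2" "coords g (\<phi>(m := 0))" using insert.IH by blast
    have h: "conj_slide m (wave ^\<^sub>F \<phi> m) \<in> PL2" using wave_PL2 by blast
    have "coords (g \<circ>\<^sub>F conj_slide m (wave ^\<^sub>F \<phi> m))
        (\<lambda>n. (\<phi>(m := 0)) n + (if n - m = 0 then \<phi> m else 0))"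
      using coords_mult[OF g h coords_conj_slide[OF pow_F_closed[OF wave_PL2] coords_wave_pow]] .
    moreover have "(\<lambda>n. (\<phi>(m := 0)) n + (if n - m = 0 then \<phi> m else 0)) = \<phi>" by auto
    ultimately show ?case using g h by auto
  qed
  then show thesis using assms that by blast
qed

text \<open>The centralizer of all conjugates of \<open>wave\<close>, a form that a formula can
  express; \<open>base_group_iff\<close> identifies it with the finitely supported coordinate
  functions.\<close>

definition base_group :: "(real \<Rightarrow> real) set" where
  "base_group = {g \<in> PL2. \<forall>n. g \<circ>\<^sub>F conj_slide n wave = conj_slide n wave \<circ>\<^sub>F g}"

text \<open>Conjugating back by \<open>n\<close> turns commuting with the \<open>n\<close>-th
  conjugate into commuting with \<open>wave\<close> itself, where \<open>wave_centralizer\<close>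
  applies.\<close>

lemma base_group_coords:
  assumes "g \<in> base_group"
  obtains \<phi> where "coords g \<phi>"
proof -
  have g: "g \<in> PL2" "\<And>n. g \<circ>\<^sub>F conj_slide n wave = conj_slide n wave \<circ>\<^sub>F g"
    using assms by (auto simp: base_group_def)
  have "\<exists>k. \<forall>x\<in>{1/2..3/4}. conj_slide (- n) g x = (wave ^\<^sub>F k) x" for n
  proof -
    have "conj_slide (- n) (g \<circ>\<^sub>F conj_slide n wave) = conj_slide (- n) (conj_slide n wave \<circ>\<^sub>F g)"
      using g(2) by simp
    then have "conj_slide (- n) g \<circ>\<^sub>F wave = wave \<circ>\<^sub>F conj_slide (- n) g"
      using g(1) wave_PL2 by (simp add: conj_slide_mult conj_slide_conj_slide conj_slide_0)
    then show ?thesis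
      using wave_centralizer[OF conj_slide_closed[OF g(1)]] by metis
  qed
  then show thesis using that unfolding coords_def by metis
qed

lemma coords_fixes_ends:
  assumes g: "g \<in> PL2" "coords g \<phi>"
  shows "g ((slide ^\<^sub>F n) (3/4)) = (slide ^\<^sub>F n) (3/4)"
proof -
  let ?p = "(slide ^\<^sub>F n) (3/4)"
  have p: "?p \<in> {0..1}" using PL2_range[OF pow_F_closed[OF slide_PL2], of "3/4"] by simp
  have "(slide ^\<^sub>F (- n)) (g ?p) = 3/4"
    using coordsD[OF g(2), of "3/4" n] unfolding wave_pow_ends
    by (simp add: conj_slide_apply g(1))
  then show ?thesis using pow_F_cancel(2)[OF slide_PL2 PL2_range[OF g(1) p], of n] by metis
qed

lemma coords_zero_if_tile_fixed:
  assumes g: "g \<in> PL2" "coords g \<phi>"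
    and tile: "\<And>x. x \<in> {1/2..3/4} \<Longrightarrow> g ((slide ^\<^sub>F n) x) = (slide ^\<^sub>F n) x"
  shows "\<phi> n = 0"
proof (rule wave_pow_inject)
  fix x :: real assume x: "x \<in> {1/2..3/4}"
  then have x01: "x \<in> {0..1}" by auto
  show "(wave ^\<^sub>F \<phi> n) x = (wave ^\<^sub>F 0) x"
    using coordsD[OF g(2) x, of n] tile[OF x] pow_F_cancel(1)[OF slide_PL2 x01, of n] x01
    by (simp add: conj_slide_apply g(1))
qed

text \<open>The end points of the tiles are fixed and accumulate at \<open>0\<close> and \<open>1\<close>, where \<open>g\<close> is linear;
  so \<open>g\<close> is the identity near \<open>0\<close> and \<open>1\<close>.\<close>

lemma coords_finite_support:
  assumes g: "g \<in> PL2" "coords g \<phi>"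
  shows "finite {n. \<phi> n \<noteq> 0}"
proof -
  obtain k where "germ 0 g k" by (rule germ_exists[OF g(1) _ _ PL2_0[OF g(1)]]) auto
  then obtain d where d: "d > 0" "\<And>x. 0 \<le> x \<Longrightarrow> x \<le> d \<Longrightarrow> g x = 2 powi k * x"
    unfolding germ_def by auto
  obtain N :: nat where N: "(slide ^\<^sub>F int N) (3/4) < d"
    by (rule slide.pow_attracted[of "3/4" d]) (use d in auto)
  let ?p = "(slide ^\<^sub>F int N) (3/4)"
  have p: "0 < ?p" using slide.pow_mem[of "3/4"] by simp
  \<comment> \<open>A nonzero fixed point in the linear range forces slope 1.\<close>
  have "2 powi k * ?p = ?p" using d(2)[of ?p] N p coords_fixes_ends[OF g, of "int N"] by simp
  then have k: "(2::real) powi k = 1" using p by simp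
  have upper: "\<phi> n = 0" if n: "int N \<le> n" for n
  proof (rule coords_zero_if_tile_fixed[OF g])
    fix x :: real assume x: "x \<in> {1/2..3/4}"
    have "(slide ^\<^sub>F n) x \<le> (slide ^\<^sub>F n) (3/4)" by (rule slide_pow_mono) (use x in auto)
    also have "\<dots> \<le> ?p" by (rule slide.pow_le) (use n in auto)
    finally show "g ((slide ^\<^sub>F n) x) = (slide ^\<^sub>F n) x"
      using d(2)[of "(slide ^\<^sub>F n) x"] N slide.pow_mem(1)[of x n] x k by simp
  qed
  obtain e l where e: "0 < e" "e \<le> 1" "\<And>x. 1 - e \<le> x \<Longrightarrow> x \<le> 1 \<Longrightarrow> g x = 1 - 2 powi (l::int) * (1 - x)"
    by (rule left_slope_at_1[OF g(1)]) blast
  \<comment> \<open>A tile end in the linear range at 1 is needed. If \<open>e = 1\<close>, the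
    point 1/2 serves; otherwise \<open>1 - e\<close> is interior, and the power that pulls it below
    1/2 is inverted.\<close>
  obtain M :: nat where M: "1 - e \<le> (slide ^\<^sub>F (- int M)) (1/2)"
  proof (cases "e = 1")
    case True
    then show thesis using that[of 0] by simp
  next
    case False
    then have e1: "0 < 1 - e" "1 - e < 1" using e by auto
    obtain M :: nat where "(slide ^\<^sub>F int M) (1 - e) < 1/2"
      by (rule slide.pow_attracted[OF e1, of "1/2"]) auto
    then have "(slide ^\<^sub>F (- int M)) ((slide ^\<^sub>F int M) (1 - e)) \<le> (slide ^\<^sub>F (- int M)) (1/2)"
      using slide.pow_mem[OF e1, of "int M"] by (intro slide_pow_mono) auto
    then show thesis using that[of M] pow_F_cancel(1)[OF slide_PL2, of "1 - e" "int M"] e1 by simp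
  qed
  let ?q = "(slide ^\<^sub>F (- int M)) (1/2)"
  have q: "?q < 1" using slide.pow_mem[of "1/2"] by simp
  \<comment> \<open>The left end of a tile is rewritten as the right end of the next, the form
    covered by \<open>coords_fixes_ends\<close>.\<close>
  have "g ?q = ?q" using coords_fixes_ends[OF g] by (simp only: slide_pow_half)
  moreover have "g ?q = 1 - 2 powi l * (1 - ?q)" by (rule e(3)) (use M q in auto)
  ultimately have "(2 powi l - 1) * (1 - ?q) = 0" by (simp add: algebra_simps)
  then have l: "(2::real) powi l = 1" using q by auto
  have lower: "\<phi> n = 0" if n: "n \<le> - int M" for n
  proof (rule coords_zero_if_tile_fixed[OF g])
    fix x :: real assume x: "x \<in> {1/2..3/4}"
    note M
    also have "?q \<le> (slide ^\<^sub>F n) (1/2)" by (rule slide.pow_le) (use n in auto)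
    also have "\<dots> \<le> (slide ^\<^sub>F n) x" by (rule slide_pow_mono) (use x in auto)
    finally show "g ((slide ^\<^sub>F n) x) = (slide ^\<^sub>F n) x"
      using e(3)[of "(slide ^\<^sub>F n) x"] slide.pow_mem(2)[of x n] x l by simp
  qed
  have "{n. \<phi> n \<noteq> 0} \<subseteq> {- int M..int N}"
    using upper lower by (auto simp: not_less [symmetric] dest: less_imp_le)
  then show ?thesis by (rule finite_subset) simp
qed

text \<open>For the converse, coordinates add and addition is commutative, so both products have
  equal coordinates and \<open>coords_unique_map\<close> makes them equal.\<close>

lemma base_group_iff:
  "g \<in> base_group \<longleftrightarrow> g \<in> PL2 \<and> (\<exists>\<phi>. finite {n. \<phi> n \<noteq> 0} \<and> coords g \<phi>)"
proof
  assume g: "g \<in> base_group"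
  then obtain \<phi> where "coords g \<phi>" by (rule base_group_coords)
  then show "g \<in> PL2 \<and> (\<exists>\<phi>. finite {n. \<phi> n \<noteq> 0} \<and> coords g \<phi>)"
    using g coords_finite_support by (auto simp: base_group_def)
next
  assume "g \<in> PL2 \<and> (\<exists>\<phi>. finite {n. \<phi> n \<noteq> 0} \<and> coords g \<phi>)"
  then obtain \<phi> where g: "g \<in> PL2" "coords g \<phi>" by blast
  have "g \<circ>\<^sub>F conj_slide n wave = conj_slide n wave \<circ>\<^sub>F g" for n
  proof -
    obtain \<psi> where h: "conj_slide n wave \<in> PL2" "coords (conj_slide n wave) \<psi>"
      using coords_conj_slide[OF wave_PL2, of _ n] coords_wave_pow[of 1] wave_PL2 by fastforce
    show ?thesis
      using coords_unique_map[OF _ coords_mult[OF g h], of "conj_slide n wave \<circ>\<^sub>F g"] coords_mult[OF h g] g h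
      by (simp add: add.commute)
  qed
  then show "g \<in> base_group" using g by (simp add: base_group_def)
qed

section \<open>Definable copies\<close>

lemma term_value_cong:
  "(\<And>i. i \<in> term_vars t \<Longrightarrow> e i = e' i) \<Longrightarrow> term_value M e t = term_value M e' t"
  by (induction t) auto

lemma satisfies_cong:
  "(\<And>i. i \<in> free_vars \<phi> \<Longrightarrow> e i = e' i) \<Longrightarrow> satisfies M e \<phi> \<longleftrightarrow> satisfies M e' \<phi>"
proof (induction \<phi> arbitrary: e e')
  case (Eq s t)
  have "term_value M e s = term_value M e' s" "term_value M e t = term_value M e' t"
    by (rule term_value_cong; simp add: Eq.prems)+
  then show ?case by simp
next
  case (Neg \<phi>)
  have "satisfies M e \<phi> \<longleftrightarrow> satisfies M e' \<phi>"
    by (rule Neg.IH) (simp add: Neg.prems)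
  then show ?case by simp
next
  case (Conj \<phi> \<psi>)
  have "satisfies M e \<phi> \<longleftrightarrow> satisfies M e' \<phi>" "satisfies M e \<psi> \<longleftrightarrow> satisfies M e' \<psi>"
    by (rule Conj.IH; simp add: Conj.prems)+
  then show ?case by simp
next
  case (Exists i \<phi>)
  have "satisfies M (e(i := a)) \<phi> \<longleftrightarrow> satisfies M (e'(i := a)) \<phi>" for a
    by (rule Exists.IH) (simp add: Exists.prems)
  then show ?case by simp
qed

text \<open>Since \<open>Var 0\<close> is the only free variable of \<open>\<phi>\<close>, the formula
  \<open>\<exists>v\<^sub>0. v\<^sub>0 = v\<^sub>1 \<and> \<phi>\<close> substitutes \<open>v\<^sub>1\<close> into \<open>\<phi>\<close> without renaming bound variables.\<close>

lemma interprets_definable_copy: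
  assumes N: "monoid N" and emb: "\<psi> \<in> hom N M" "inj_on \<psi> (carrier N)"
    and df: "definable M 1 ((\<lambda>x. [x]) ` \<psi> ` carrier N)"
  shows "interprets_with_parameters M N"
proof -
  define D where "D = (\<lambda>x. [x]) ` \<psi> ` carrier N"
  \<comment> \<open>The equivalence will be equality on \<open>D\<close>; each class is then a
    singleton \<open>{[\<psi> a]}\<close>, from which \<open>h\<close> recovers
    \<open>a\<close>.\<close>
  define h where "h = (\<lambda>C. the_inv_into (carrier N) \<psi> (hd (the_elem C)))"
  obtain \<phi> where \<phi>: "set_grp_formula \<phi> \<subseteq> carrier M" "free_vars \<phi> \<subseteq> {..<1}"
    and D: "D = {xs \<in> tuples M 1. satisfies M ((!) xs) \<phi>}"
    using df unfolding definable_def D_def by blast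
  have sat: "satisfies M e \<phi> \<longleftrightarrow> e 0 \<in> \<psi> ` carrier N" if "e 0 \<in> carrier M" for e
  proof -
    have "satisfies M e \<phi> \<longleftrightarrow> satisfies M ((!) [e 0]) \<phi>"
      by (rule satisfies_cong) (use \<phi>(2) in auto)
    also have "\<dots> \<longleftrightarrow> [e 0] \<in> D" using that by (simp add: D tuples_def)
    also have "\<dots> \<longleftrightarrow> e 0 \<in> \<psi> ` carrier N" by (auto simp: D_def)
    finally show ?thesis .
  qed
  have \<psi>_closed: "\<psi> a \<in> carrier M" if "a \<in> carrier N" for a
    using emb(1) that by (auto simp: hom_def)
  have \<psi>_mult: "\<psi> (a \<otimes>\<^bsub>N\<^esub> b) = \<psi> a \<otimes>\<^bsub>M\<^esub> \<psi> b" if "a \<in> carrier N" "b \<in> carrier N" for a b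
    using emb(1) that by (auto simp: hom_def)
  have h: "h (Id_on D `` {[\<psi> a]}) = a" if "a \<in> carrier N" for a
  proof -
    have "Id_on D `` {[\<psi> a]} = {[\<psi> a]}" using that by (auto simp: D_def)
    then show ?thesis using that emb(2) by (simp add: h_def the_inv_into_f_f)
  qed
  have eq: "equiv D (Id_on D)" by (auto simp: equiv_def refl_on_def sym_def trans_def)
  have bij: "bij_betw h (D // Id_on D) (carrier N)"
  proof (rule bij_betw_byWitness[where f' = "\<lambda>a. Id_on D `` {[\<psi> a]}"])
    show "\<forall>C\<in>D // Id_on D. Id_on D `` {[\<psi> (h C)]} = C"
      using h by (auto simp: quotient_def D_def)
    show "h ` (D // Id_on D) \<subseteq> carrier N"
      using h by (auto simp: quotient_def D_def)
    show "(\<lambda>a. Id_on D `` {[\<psi> a]}) ` carrier N \<subseteq> D // Id_on D"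
      by (auto simp: quotient_def D_def)
  qed (use h in simp)
  have def2: "definable M (2 * 1) {xs @ ys | xs ys. (xs, ys) \<in> Id_on D}"
    unfolding definable_def
  proof (intro exI conjI)
    let ?\<phi> = "Conj \<phi> (Eq (Var 0) (Var 1))"
    show "set_grp_formula ?\<phi> \<subseteq> carrier M" "free_vars ?\<phi> \<subseteq> {..<2 * 1}" using \<phi> by auto
    have "{xs @ ys | xs ys. (xs, ys) \<in> Id_on D} = (\<lambda>d. d @ d) ` D" by auto
    also have "\<dots> = (\<lambda>a. [\<psi> a, \<psi> a]) ` carrier N" by (simp add: D_def image_image)
    also have "\<dots> = {xs \<in> tuples M (2 * 1). satisfies M ((!) xs) ?\<phi>}"
      by (auto simp: sat tuples_def \<psi>_closed numeral_2_eq_2 length_Suc_conv)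
    finally show "{xs @ ys | xs ys. (xs, ys) \<in> Id_on D} = {xs \<in> tuples M (2 * 1). satisfies M ((!) xs) ?\<phi>}" .
  qed
  have def3: "definable M (3 * 1) {xs @ ys @ zs | xs ys zs. xs \<in> D \<and> ys \<in> D \<and> zs \<in> D \<and>
      h (Id_on D `` {xs}) \<otimes>\<^bsub>N\<^esub> h (Id_on D `` {ys}) = h (Id_on D `` {zs})}" (is "definable _ _ ?S")
    unfolding definable_def
  proof (intro exI conjI)
    \<comment> \<open>Membership is tested for the two factors; the product lies in the image
      because \<psi> is multiplicative.\<close>
    let ?\<phi> = "Conj \<phi> (Conj (Exists 0 (Conj (Eq (Var 0) (Var 1)) \<phi>)) (Eq (Mult (Var 0) (Var 1)) (Var 2)))"
    show "set_grp_formula ?\<phi> \<subseteq> carrier M" "free_vars ?\<phi> \<subseteq> {..<3 * 1}" using \<phi> by auto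
    have "?S = {[\<psi> a, \<psi> b, \<psi> (a \<otimes>\<^bsub>N\<^esub> b)] | a b. a \<in> carrier N \<and> b \<in> carrier N}"
      (is "_ = ?T")
    proof (intro equalityI subsetI)
      fix s assume "s \<in> ?S"
      then obtain a b c where "a \<in> carrier N" "b \<in> carrier N" "c \<in> carrier N"
          "h (Id_on D `` {[\<psi> a]}) \<otimes>\<^bsub>N\<^esub> h (Id_on D `` {[\<psi> b]}) = h (Id_on D `` {[\<psi> c]})"
          "s = [\<psi> a] @ [\<psi> b] @ [\<psi> c]"
        unfolding D_def by blast
      then show "s \<in> ?T" using h by fastforce
    next
      fix s assume "s \<in> ?T"
      then obtain a b where ab: "a \<in> carrier N" "b \<in> carrier N" "s = [\<psi> a] @ [\<psi> b] @ [\<psi> (a \<otimes>\<^bsub>N\<^esub> b)]"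
        by auto
      then have ab': "a \<otimes>\<^bsub>N\<^esub> b \<in> carrier N" using N by (simp add: monoid.m_closed)
      show "s \<in> ?S"
      proof (intro CollectI exI conjI)
        show "s = [\<psi> a] @ [\<psi> b] @ [\<psi> (a \<otimes>\<^bsub>N\<^esub> b)]" by (fact ab(3))
        show "h (Id_on D `` {[\<psi> a]}) \<otimes>\<^bsub>N\<^esub> h (Id_on D `` {[\<psi> b]}) =
            h (Id_on D `` {[\<psi> (a \<otimes>\<^bsub>N\<^esub> b)]})"
          by (simp only: h ab(1,2) ab')
      qed (use ab(1,2) ab' in \<open>simp_all add: D_def\<close>)
    qed
    also have "\<dots> = {xs \<in> tuples M (3 * 1). satisfies M ((!) xs) ?\<phi>}"
    proof (intro equalityI subsetI)
      fix s assume "s \<in> ?T"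
      then obtain a b where "a \<in> carrier N" "b \<in> carrier N" "s = [\<psi> a, \<psi> b, \<psi> a \<otimes>\<^bsub>M\<^esub> \<psi> b]"
        using \<psi>_mult by auto
      moreover from this have "\<psi> a \<otimes>\<^bsub>M\<^esub> \<psi> b \<in> carrier M"
        using \<psi>_closed[OF monoid.m_closed[OF N]] \<psi>_mult by fastforce
      ultimately show "s \<in> {xs \<in> tuples M (3 * 1). satisfies M ((!) xs) ?\<phi>}"
        by (simp add: sat tuples_def \<psi>_closed)
    next
      fix s assume "s \<in> {xs \<in> tuples M (3 * 1). satisfies M ((!) xs) ?\<phi>}"
      then have s: "s \<in> tuples M 3" "satisfies M ((!) s) ?\<phi>" by simp_all
      then obtain x y z where xyz: "s = [x, y, z]" "x \<in> carrier M" "y \<in> carrier M"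
        by (auto simp: tuples_def numeral_3_eq_3 length_Suc_conv)
      with s(2) have "x \<in> \<psi> ` carrier N" "y \<in> \<psi> ` carrier N" "z = x \<otimes>\<^bsub>M\<^esub> y"
        by (simp_all add: sat)
      then show "s \<in> ?T" using xyz(1) \<psi>_mult by fastforce
    qed
    finally show "?S = {xs \<in> tuples M (3 * 1). satisfies M ((!) xs) ?\<phi>}" .
  qed
  show ?thesis
    unfolding interprets_with_parameters_def
  proof (intro exI conjI)
    show "(1::nat) \<le> 1" by simp
    show "definable M 1 D" using df by (simp only: D_def)
  qed (fact eq def2 bij def3)+
qed

section \<open>The embedding of the wreath product\<close>

definition All :: "nat \<Rightarrow> 'a grp_formula \<Rightarrow> 'a grp_formula" where
  "All i \<phi> = Neg (Exists i (Neg \<phi>))"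

definition Imp :: "'a grp_formula \<Rightarrow> 'a grp_formula \<Rightarrow> 'a grp_formula" where
  "Imp \<phi> \<psi> = Neg (Conj \<phi> (Neg \<psi>))"

definition Commute :: "'a grp_term \<Rightarrow> 'a grp_term \<Rightarrow> 'a grp_formula" where
  "Commute s t = Eq (Mult s t) (Mult t s)"

text \<open>Quantification over integers is replaced by quantification over elements commuting with
  \<open>slide\<close>, which are exactly its powers.\<close>

definition base_formula :: "nat \<Rightarrow> (real \<Rightarrow> real) grp_formula" where
  "base_formula v = All 3 (Imp (Commute (Var 3) (Param slide))
     (Commute (Var v) (Mult (Mult (Var 3) (Param wave)) (Inv (Var 3)))))"

text \<open>Variable 1 ranges over powers of \<open>slide\<close>, variable 2 over the base
  group.\<close>

definition wreath_formula :: "(real \<Rightarrow> real) grp_formula" where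
  "wreath_formula = Exists 1 (Exists 2 (Conj (Commute (Var 1) (Param slide))
     (Conj (base_formula 2) (Eq (Var 0) (Mult (Var 2) (Var 1))))))"

lemma satisfies_base_formula:
  assumes "v \<noteq> 3" "e v \<in> PL2"
  shows "satisfies thompson_F e (base_formula v) \<longleftrightarrow> e v \<in> base_group"
proof -
  have "satisfies thompson_F e (base_formula v) \<longleftrightarrow>
      (\<forall>c\<in>PL2. c \<circ>\<^sub>F slide = slide \<circ>\<^sub>F c \<longrightarrow>
        e v \<circ>\<^sub>F (c \<circ>\<^sub>F wave \<circ>\<^sub>F inv\<^bsub>thompson_F\<^esub> c) = c \<circ>\<^sub>F wave \<circ>\<^sub>F inv\<^bsub>thompson_F\<^esub> c \<circ>\<^sub>F e v)"
    using assms(1) by (simp add: base_formula_def All_def Imp_def Commute_def)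
  also have "\<dots> \<longleftrightarrow> (\<forall>n. e v \<circ>\<^sub>F conj_slide n wave = conj_slide n wave \<circ>\<^sub>F e v)"
    using slide_PL2 by (auto simp: slide_centralizer conj_slide_def thompson.int_pow_neg)
  finally show ?thesis using assms(2) by (simp add: base_group_def)
qed

lemma definable_wreath:
  "definable thompson_F 1 ((\<lambda>x. [x]) ` {g \<circ>\<^sub>F slide ^\<^sub>F n | g n. g \<in> base_group})"
  unfolding definable_def
proof (intro exI[of _ wreath_formula] conjI)
  show "set_grp_formula wreath_formula \<subseteq> carrier thompson_F"
    using slide_PL2 wave_PL2
    by (auto simp: wreath_formula_def base_formula_def All_def Imp_def Commute_def)
  show "free_vars wreath_formula \<subseteq> {..<1}"
    by (auto simp: wreath_formula_def base_formula_def All_def Imp_def Commute_def)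
  have base: "g \<in> PL2" if "g \<in> base_group" for g using that by (simp add: base_group_def)
  have sat: "satisfies thompson_F e wreath_formula \<longleftrightarrow>
      e 0 \<in> {g \<circ>\<^sub>F slide ^\<^sub>F n | g n. g \<in> base_group}" for e
  proof -
    have "satisfies thompson_F e wreath_formula \<longleftrightarrow>
        (\<exists>c\<in>PL2. \<exists>g\<in>PL2. c \<circ>\<^sub>F slide = slide \<circ>\<^sub>F c \<and> g \<in> base_group \<and> e 0 = g \<circ>\<^sub>F c)"
      by (simp add: wreath_formula_def satisfies_base_formula Commute_def cong: conj_cong)
    also have "\<dots> \<longleftrightarrow> e 0 \<in> {g \<circ>\<^sub>F slide ^\<^sub>F n | g n. g \<in> base_group}"
      using slide_PL2 base by (auto simp: slide_centralizer)
    finally show ?thesis .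
  qed
  have "{g \<circ>\<^sub>F slide ^\<^sub>F n | g n. g \<in> base_group} \<subseteq> PL2"
    using slide_PL2 base by blast
  then show "(\<lambda>x. [x]) ` {g \<circ>\<^sub>F slide ^\<^sub>F n | g n. g \<in> base_group} =
      {xs \<in> tuples thompson_F 1. satisfies thompson_F ((!) xs) wreath_formula}"
    unfolding sat tuples_def by (auto simp only: image_iff thompson_F_carrier mem_Collect_eq length_Suc_conv One_nat_def list.size)
      (auto simp: subset_iff)
qed

text \<open>The inverse of taking coordinates; it is meaningful for finite support, where
  \<open>coords_exist\<close> and \<open>coords_unique_map\<close> apply.\<close>

definition base_elem :: "(int \<Rightarrow> int) \<Rightarrow> real \<Rightarrow> real" where
  "base_elem \<phi> = (THE g. g \<in> PL2 \<and> coords g \<phi>)"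

lemma base_elem_eq: "g \<in> PL2 \<Longrightarrow> coords g \<phi> \<Longrightarrow> base_elem \<phi> = g"
  unfolding base_elem_def using coords_unique_map by blast

lemma base_elem:
  assumes "finite {n. \<phi> n \<noteq> 0}"
  shows "base_elem \<phi> \<in> PL2" "coords (base_elem \<phi>) \<phi>"
  using coords_exist[OF assms] base_elem_eq by metis+

definition wreath_embed :: "(int \<Rightarrow> int) \<times> int \<Rightarrow> real \<Rightarrow> real" where
  "wreath_embed = (\<lambda>(\<phi>, m). base_elem \<phi> \<circ>\<^sub>F slide ^\<^sub>F m)"

section \<open>The abstract wreath product and its embedding\<close>

lemma Z_wr_Z_carrier: "carrier Z_wr_Z = {\<phi>. finite {n. \<phi> n \<noteq> 0}} \<times> UNIV"
  by (simp add: Z_wr_Z_def semidirect_product_def carrier_sum_group)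

lemma Z_wr_Z_mult: "(\<phi>, m) \<otimes>\<^bsub>Z_wr_Z\<^esub> (\<psi>, n) = ((\<lambda>k. \<phi> k + \<psi> (k - m)), m + n)"
  by (simp add: Z_wr_Z_def semidirect_product_def restrict_def)

lemma finite_support_add:
  fixes \<phi> \<psi> :: "int \<Rightarrow> int"
  assumes "finite {n. \<phi> n \<noteq> 0}" "finite {n. \<psi> n \<noteq> 0}"
  shows "finite {n. \<phi> n + \<psi> (n - m) \<noteq> 0}"
proof (rule finite_subset)
  show "{n. \<phi> n + \<psi> (n - m) \<noteq> 0} \<subseteq> {n. \<phi> n \<noteq> 0} \<union> (\<lambda>n. n + m) ` {n. \<psi> n \<noteq> 0}"
    by (force simp: image_iff intro: exI[of _ "_ - m"])
qed (use assms in simp)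

lemma Z_wr_Z_monoid: "monoid Z_wr_Z"
proof (rule monoidI)
  show "x \<otimes>\<^bsub>Z_wr_Z\<^esub> y \<in> carrier Z_wr_Z" if "x \<in> carrier Z_wr_Z" "y \<in> carrier Z_wr_Z" for x y
    using that finite_support_add by (auto simp: Z_wr_Z_carrier Z_wr_Z_mult)
  have one: "\<one>\<^bsub>Z_wr_Z\<^esub> = (\<lambda>_. 0, 0)"
    by (simp add: Z_wr_Z_def semidirect_product_def restrict_def)
  then show "\<one>\<^bsub>Z_wr_Z\<^esub> \<in> carrier Z_wr_Z" by (simp add: Z_wr_Z_carrier)
  show "\<one>\<^bsub>Z_wr_Z\<^esub> \<otimes>\<^bsub>Z_wr_Z\<^esub> x = x" "x \<otimes>\<^bsub>Z_wr_Z\<^esub> \<one>\<^bsub>Z_wr_Z\<^esub> = x" for x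
    by (cases x; simp add: one Z_wr_Z_mult)+
  show "x \<otimes>\<^bsub>Z_wr_Z\<^esub> y \<otimes>\<^bsub>Z_wr_Z\<^esub> z = x \<otimes>\<^bsub>Z_wr_Z\<^esub> (y \<otimes>\<^bsub>Z_wr_Z\<^esub> z)" for x y z
    by (cases x; cases y; cases z) (simp add: Z_wr_Z_mult algebra_simps)
qed

text \<open>Moving \<open>slide ^\<^sub>F m\<close> past a base element conjugates it, which shifts
  its coordinates by \<open>m\<close> as in the semidirect product.\<close>

lemma wreath_embed_hom: "wreath_embed \<in> hom Z_wr_Z thompson_F"
proof (rule homI)
  show "wreath_embed x \<in> carrier thompson_F" if "x \<in> carrier Z_wr_Z" for x
    using that slide_PL2 base_elem(1) by (auto simp: wreath_embed_def Z_wr_Z_carrier)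
  fix x y assume "x \<in> carrier Z_wr_Z" "y \<in> carrier Z_wr_Z"
  then obtain \<phi> m \<psi> n where xy: "x = (\<phi>, m)" "y = (\<psi>, n)"
    and fin: "finite {n. \<phi> n \<noteq> 0}" "finite {n. \<psi> n \<noteq> 0}"
    by (auto simp: Z_wr_Z_carrier)
  note [simp] = slide_PL2 base_elem(1)[OF fin(1)] base_elem(1)[OF fin(2)]
  have "coords (base_elem \<phi> \<circ>\<^sub>F conj_slide m (base_elem \<psi>)) (\<lambda>k. \<phi> k + \<psi> (k - m))"
    by (intro coords_mult coords_conj_slide base_elem fin conj_slide_closed)
  then have "base_elem (\<lambda>k. \<phi> k + \<psi> (k - m)) = base_elem \<phi> \<circ>\<^sub>F conj_slide m (base_elem \<psi>)"
    by (intro base_elem_eq) simp_all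
  moreover have "slide ^\<^sub>F (- m) \<circ>\<^sub>F slide ^\<^sub>F (m + n) = slide ^\<^sub>F n"
    using pow_F_add[of slide "- m" "m + n"] by simp
  ultimately show "wreath_embed (x \<otimes>\<^bsub>Z_wr_Z\<^esub> y) = wreath_embed x \<circ>\<^sub>F wreath_embed y"
    by (simp add: xy wreath_embed_def Z_wr_Z_mult conj_slide_def thompson.m_assoc)
qed

text \<open>Base elements fix 3/4, so the image of \<open>(\<phi>, m)\<close> sends the
  \<open>- m\<close>-th point of the \<open>slide\<close> orbit of 3/4 to 3/4. Orbit points are
  distinct, so this determines \<open>m\<close>; cancelling the power leaves the base elements,
  whose coordinates are unique.\<close>

lemma wreath_embed_inj: "inj_on wreath_embed (carrier Z_wr_Z)"
proof (rule inj_onI)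
  fix x y assume "x \<in> carrier Z_wr_Z" "y \<in> carrier Z_wr_Z" and eq: "wreath_embed x = wreath_embed y"
  then obtain \<phi> m \<psi> n where xy: "x = (\<phi>, m)" "y = (\<psi>, n)"
    and fin: "finite {n. \<phi> n \<noteq> 0}" "finite {n. \<psi> n \<noteq> 0}"
    by (auto simp: Z_wr_Z_carrier)
  let ?p = "\<lambda>k. (slide ^\<^sub>F k) (3/4)"
  have p: "?p k \<in> {0..1}" for k using PL2_range[OF pow_F_closed[OF slide_PL2], of "3/4"] by simp
  have val: "(base_elem \<phi> \<circ>\<^sub>F slide ^\<^sub>F m) (?p (- m)) = 3/4" if "finite {n. \<phi> n \<noteq> 0}" for \<phi> m
  proof -
    have "(base_elem \<phi> \<circ>\<^sub>F slide ^\<^sub>F m) (?p (- m)) = base_elem \<phi> ((slide ^\<^sub>F m) (?p (- m)))"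
      by (rule thompson_F_mult_apply[OF p])
    also have "(slide ^\<^sub>F m) (?p (- m)) = 3/4" by (rule pow_F_cancel(2)[OF slide_PL2]) simp
    also have "base_elem \<phi> (3/4) = 3/4" using coords_fixes_ends[OF base_elem[OF that], of 0] by simp
    finally show ?thesis .
  qed
  have "wreath_embed x (?p (- m)) = wreath_embed x (?p (- n))"
    unfolding eq using val[OF fin(1), of m] val[OF fin(2), of n] eq unfolding xy wreath_embed_def by simp
  moreover have "wreath_embed x \<in> PL2"
    using slide_PL2 base_elem(1)[OF fin(1)] by (simp add: xy wreath_embed_def)
  ultimately have "?p (- m) = ?p (- n)" using PL2_inj[THEN inj_onD] p by blast
  then have mn: "m = n"
    using slide.pow_lt[of "3/4" "- m" "- n"] slide.pow_lt[of "3/4" "- n" "- m"]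
    by (cases m n rule: linorder_cases) auto
  then have "base_elem \<phi> = base_elem \<psi>"
    using eq thompson.r_cancel slide_PL2 base_elem(1)[OF fin(1)] base_elem(1)[OF fin(2)]
    by (simp add: xy wreath_embed_def)
  then have "\<phi> = \<psi>" using coords_unique_fun base_elem(2)[OF fin(1)] base_elem(2)[OF fin(2)] by metis
  then show "x = y" using mn xy by simp
qed

lemma wreath_embed_image:
  "wreath_embed ` carrier Z_wr_Z = {g \<circ>\<^sub>F slide ^\<^sub>F n | g n. g \<in> base_group}"
proof -
  have "base_group = base_elem ` {\<phi>. finite {n. \<phi> n \<noteq> 0}}"
  proof (intro equalityI subsetI)
    fix g assume "g \<in> base_group"
    then show "g \<in> base_elem ` {\<phi>. finite {n. \<phi> n \<noteq> 0}}"
      using base_elem_eq unfolding base_group_iff by blast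
  qed (use base_elem in \<open>auto simp: base_group_iff\<close>)
  then have "{g \<circ>\<^sub>F slide ^\<^sub>F n | g n. g \<in> base_group} =
      {base_elem \<phi> \<circ>\<^sub>F slide ^\<^sub>F n | \<phi> n. finite {n. \<phi> n \<noteq> 0}}"
    by (simp add: set_eq_iff image_iff) metis
  then show ?thesis by (auto simp: Z_wr_Z_carrier wreath_embed_def)
qed

theorem mainTheorem2:
  shows "interprets_with_parameters thompson_F Z_wr_Z"
  using interprets_definable_copy[OF Z_wr_Z_monoid wreath_embed_hom wreath_embed_inj]
    definable_wreath wreath_embed_image by simp

end
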